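(* Let $R$ be a prime ring, $A$ an integrally closed subring of the center of $R$ whose fraction field $F$ has characteristic $0$, with $R$ a finitely generated $A$-module, and let $n=[R:A]$. If $\tau:R\to A$ is any trace (with values in $A$) for which $R$ is an $m$-Cayley–Hamilton algebra, then there is a positive integer $r$ such that $m=rn$ and $\tau=r\,t_{R/A}$.
   Context: $S=R\otimes_AF\cong M_k(D)$, $D$ a division ring with center $Z$, $\dim_ZD=h^2$, $p=[Z:F]$; $[R:A]:=hkp$; the reduced trace $t_{R/A}$ is the restriction to $R$ of $t_{S/F}(a)=\frac{1}{hk}\operatorname{tr}_F(L_a)$, $L_a$ left multiplication by $a$ on $S$ (it takes values in $A$). A trace on $R$ with values in $A$ is an $A$-linear map $\tau:R\to A$ with $\tau(ab)=\tau(ba)$ (and $\tau(\tau(a)b)=\tau(a)\tau(b)$). $R$ is $m$-Cayley–Hamilton for $\tau$ if $\tau(1)=m$ and $\chi^m_a(a)=0$ for all $a$, where $\chi^m_a(x)=x^m+\sum_{i=1}^mP_i(\tau(a),\dots,\tau(a^i))x^{m-i}$ with $P_i$ the universal rational polynomials expressing elementary symmetric functions via power sums. *)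

theory Defs
  imports "HOL-Computational_Algebra.Polynomial"
begin

definition ring_center :: "'r::ring_1 set" where
  "ring_center = {z. \<forall>x. z * x = x * z}"

text \<open>Prime ring: aRb = 0 implies a = 0 or b = 0 (R nonzero by class ring_1).\<close>
definition prime_ring :: "'r::ring_1 itself \<Rightarrow> bool" where
  "prime_ring _ \<longleftrightarrow> (\<forall>a b::'r. (\<forall>x. a * x * b = 0) \<longrightarrow> a = 0 \<or> b = 0)"

definition is_subring :: "'r::ring_1 set \<Rightarrow> bool" where
  "is_subring A \<longleftrightarrow> 0 \<in> A \<and> 1 \<in> A \<and>
     (\<forall>x\<in>A. \<forall>y\<in>A. x + y \<in> A \<and> x - y \<in> A \<and> x * y \<in> A)"

definition fin_gen_module :: "'r::ring_1 set \<Rightarrow> bool" where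
  "fin_gen_module A \<longleftrightarrow> (\<exists>G. finite G \<and>
     (\<forall>r::'r. \<exists>c. (\<forall>g\<in>G. c g \<in> A) \<and> r = (\<Sum>g\<in>G. c g * g)))"

definition is_trace :: "'r::ring_1 set \<Rightarrow> ('r \<Rightarrow> 'r) \<Rightarrow> bool" where
  "is_trace A \<tau> \<longleftrightarrow> (\<forall>x. \<tau> x \<in> A) \<and>
     (\<forall>x y. \<tau> (x + y) = \<tau> x + \<tau> y) \<and>
     (\<forall>a\<in>A. \<forall>x. \<tau> (a * x) = a * \<tau> x) \<and>
     (\<forall>x y. \<tau> (x * y) = \<tau> (y * x)) \<and>
     (\<forall>x y. \<tau> (\<tau> x * y) = \<tau> x * \<tau> y)"

text \<open>Data: F a field (type 'f), S a ring (type 'v), \<phi> : F \<rightarrow> S a ring homomorphism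
  into the centre of S, \<iota> : R \<rightarrow> S an injective ring homomorphism, and j : A \<rightarrow> F with
  \<phi> (j a) = \<iota> a.  We require F to be the fraction field of A (via j) and
  S = \<phi>(F) \<iota>(R).  Since R is A-torsion-free (R prime, A central), these conditions
  say exactly that S is R \<otimes>_A F with its canonical maps.\<close>
definition scalar_extension ::
  "'r::ring_1 set \<Rightarrow> ('r \<Rightarrow> 'f::field) \<Rightarrow> ('f \<Rightarrow> 'v::ring_1) \<Rightarrow> ('r \<Rightarrow> 'v) \<Rightarrow> bool" where
  "scalar_extension A j \<phi> \<iota> \<longleftrightarrow>
     \<phi> 1 = 1 \<and> (\<forall>x y. \<phi> (x + y) = \<phi> x + \<phi> y) \<and> (\<forall>x y. \<phi> (x * y) = \<phi> x * \<phi> y) \<and>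
     (\<forall>c s. \<phi> c * s = s * \<phi> c) \<and>
     \<iota> 1 = 1 \<and> (\<forall>x y. \<iota> (x + y) = \<iota> x + \<iota> y) \<and> (\<forall>x y. \<iota> (x * y) = \<iota> x * \<iota> y) \<and>
     inj \<iota> \<and>
     (\<forall>a\<in>A. \<phi> (j a) = \<iota> a) \<and>
     (\<forall>x. \<exists>a\<in>A. \<exists>b\<in>A. b \<noteq> 0 \<and> x = j a / j b) \<and>
     (\<forall>s. \<exists>c r. s = \<phi> c * \<iota> r)"

definition integrally_closed :: "'r::ring_1 set \<Rightarrow> ('r \<Rightarrow> 'f::field) \<Rightarrow> bool" where
  "integrally_closed A j \<longleftrightarrow>
     (\<forall>x::'f. (\<exists>p. lead_coeff p = 1 \<and> (\<forall>i. coeff p i \<in> j ` A) \<and> poly p x = 0) \<longrightarrow> x \<in> j ` A)"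

definition fscale :: "('f::field \<Rightarrow> 'v::ring_1) \<Rightarrow> 'f \<Rightarrow> 'v \<Rightarrow> 'v" where
  "fscale \<phi> c s = \<phi> c * s"

definition lin_trace :: "('f::field \<Rightarrow> 'v::ring_1) \<Rightarrow> ('v \<Rightarrow> 'v) \<Rightarrow> 'f" where
  "lin_trace \<phi> L =
    (let B = (SOME B. finite B \<and> \<not> module.dependent (fscale \<phi>) B \<and>
                       module.span (fscale \<phi>) B = UNIV)
     in \<Sum>b\<in>B. module.representation (fscale \<phi>) B (L b) b)"

definition center_deg :: "('f::field \<Rightarrow> 'v::ring_1) \<Rightarrow> nat" where
  "center_deg \<phi> = vector_space.dim (fscale \<phi>) (ring_center :: 'v set)"

text \<open>hk, where S \<cong> M_k(D), dim_Z D = h^2: the number d with d^2 = dim_Z S,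
  i.e. d^2 * p = dim_F S.\<close>
definition red_deg :: "('f::field \<Rightarrow> 'v::ring_1) \<Rightarrow> nat" where
  "red_deg \<phi> = (THE d. d^2 * center_deg \<phi> = vector_space.dim (fscale \<phi>) (UNIV :: 'v set))"

definition ring_index :: "('f::field \<Rightarrow> 'v::ring_1) \<Rightarrow> nat" where
  "ring_index \<phi> = red_deg \<phi> * center_deg \<phi>"

definition reduced_trace :: "('f::field \<Rightarrow> 'v::ring_1) \<Rightarrow> ('r \<Rightarrow> 'v) \<Rightarrow> 'r \<Rightarrow> 'f" where
  "reduced_trace \<phi> \<iota> x = lin_trace \<phi> (\<lambda>s. \<iota> x * s) / of_nat (red_deg \<phi>)"

text \<open>Elementary symmetric functions from power sums via Newton's identities:
  i e_i = sum_{j=1}^{i} (-1)^(j-1) e_{i-j} p_j.\<close>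
function newton_e :: "(nat \<Rightarrow> 'f::field) \<Rightarrow> nat \<Rightarrow> 'f" where
  "newton_e ps 0 = 1"
| "newton_e ps (Suc i) =
     (\<Sum>k\<in>{1..Suc i}. (-1)^(k-1) * newton_e ps (Suc i - k) * ps k) / of_nat (Suc i)"
  by pat_completeness auto
termination by (relation "measure snd") auto

text \<open>P_i(tau(a),...,tau(a^i)) = (-1)^i e_i, so
  chi_a(x) = x^m + sum_{i=1}^m (-1)^i e_i x^(m-i); evaluated at a inside S.\<close>
definition cayley_hamilton :: "'r::ring_1 set \<Rightarrow> ('r \<Rightarrow> 'f::field) \<Rightarrow> ('f \<Rightarrow> 'v::ring_1) \<Rightarrow>
    ('r \<Rightarrow> 'v) \<Rightarrow> ('r \<Rightarrow> 'r) \<Rightarrow> nat \<Rightarrow> bool" where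
  "cayley_hamilton A j \<phi> \<iota> \<tau> m \<longleftrightarrow> \<tau> 1 = of_nat m \<and>
     (\<forall>a. \<iota> a ^ m +
        (\<Sum>i\<in>{1..m}. \<phi> ((-1)^i * newton_e (\<lambda>k. j (\<tau> (a ^ k))) i) * \<iota> a ^ (m - i)) = 0)"

end

theory Submission
  imports Defs "Jordan_Normal_Form.Determinant" "HOL-Computational_Algebra.Polynomial_FPS"
begin

text \<open>
  Let \<open>\<T>\<close> be the trace of left multiplication on \<open>S\<close> and \<open>t\<close> the extension of \<open>\<tau>\<close> to \<open>S\<close>; no
  splitting field is needed. The form \<open>\<T> (x y)\<close> is nondegenerate, since a nonzero right ideal of a
  prime finite-dimensional algebra contains a nonzero idempotent \<open>e\<close>, and \<open>\<T> e = dim (e S)\<close>. For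
  \<open>\<T>\<close>-dual bases \<open>a\<^sub>i\<close>, \<open>b\<^sub>i\<close> of \<open>S\<close>, the Casimir operator \<open>C s = \<Sum> a\<^sub>i s b\<^sub>i\<close> maps \<open>S\<close> to its
  centre \<open>Z\<close> and \<open>t \<circ> C = t\<close> for every symmetric form \<open>t\<close>, so symmetric forms are determined by
  their restriction to \<open>Z\<close>. On a subfield \<open>F[x]\<close> the Cayley-Hamilton identity and Newton's
  identities force the polynomial \<open>\<Sum> (-1)\<^sup>i e\<^sub>i X\<^sup>i\<close> to be a power of the reversed minimal
  polynomial of \<open>x\<close>, up to a constant; hence \<open>t\<close> is there an integral multiple of the field trace.
  Applied to \<open>Z\<close> this gives \<open>t = (m / dim S) \<T>\<close>. Applied to a maximal subfield \<open>E = F[y]\<close> of the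
  division algebra \<open>e S e\<close>, for a primitive idempotent \<open>e\<close>, it gives \<open>t e = r [E:F]\<close> with an
  integer \<open>r\<close>. With \<open>n = dim (e S) / dim E\<close>, computing the trace of the Casimir operator of \<open>E\<close> in
  two ways shows \<open>dim S = n\<^sup>2 dim Z\<close>, so that \<open>n\<close> is the reduced degree, and the theorem follows
  by comparing dimensions.
\<close>

subsection \<open>Newton's identities and a logarithmic differential equation\<close>

lemma newton_e_Suc_mult:
  fixes ps :: "nat \<Rightarrow> 'f::field_char_0"
  shows "of_nat (Suc i) * newton_e ps (Suc i) =
    (\<Sum>k\<in>{1..Suc i}. (-1)^(k-1) * newton_e ps (Suc i - k) * ps k)"
  by (simp del: of_nat_Suc)

lemma newton_e_homogeneous:
  assumes "\<And>k. k > 0 \<Longrightarrow> qs k = c ^ k * ps k"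
  shows "newton_e qs i = c ^ i * newton_e ps i"
proof (induction i rule: less_induct)
  case (less i)
  show ?case
  proof (cases i)
    case (Suc n)
    have "(\<Sum>k\<in>{1..Suc n}. (-1)^(k-1) * newton_e qs (Suc n - k) * qs k) =
        (\<Sum>k\<in>{1..Suc n}. c ^ Suc n * ((-1)^(k-1) * newton_e ps (Suc n - k) * ps k))"
    proof (rule sum.cong[OF refl])
      fix k assume k: "k \<in> {1..Suc n}"
      then have "newton_e qs (Suc n - k) = c ^ (Suc n - k) * newton_e ps (Suc n - k)"
        using Suc by (intro less) auto
      moreover have "qs k = c ^ k * ps k" using k assms by simp
      moreover have "c ^ Suc n = c ^ (Suc n - k) * c ^ k"
        using k by (simp del: power_Suc flip: power_add)
      ultimately show "(-1)^(k-1) * newton_e qs (Suc n - k) * qs k =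
          c ^ Suc n * ((-1)^(k-1) * newton_e ps (Suc n - k) * ps k)"
        by (simp only: mult_ac)
    qed
    then show ?thesis
      unfolding Suc newton_e.simps(2)
      by (simp only: sum_distrib_left[symmetric] times_divide_eq_right)
  qed simp
qed

lemma newton_e_cong: "(\<And>k. k > 0 \<Longrightarrow> qs k = ps k) \<Longrightarrow> newton_e qs i = newton_e ps i"
  using newton_e_homogeneous[of qs 1 ps] by simp

lemma newton_e_eq_0:
  fixes ps :: "nat \<Rightarrow> 'f::field_char_0"
  assumes rec: "\<And>k. k > m \<Longrightarrow> (\<Sum>l\<le>m. (-1)^l * newton_e ps l * ps (k - l)) = 0" and "i > m"
  shows "newton_e ps i = 0"
  using \<open>i > m\<close>
proof (induction i rule: less_induct)
  case (less i)
  then obtain n where n: "i = Suc n" by (cases i) auto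
  have "of_nat i * newton_e ps i = (\<Sum>k\<in>{1..i}. (-1)^(k-1) * newton_e ps (i - k) * ps k)"
    unfolding n by (rule newton_e_Suc_mult)
  also have "\<dots> = (\<Sum>l<i. (-1)^(i - l - 1) * newton_e ps l * ps (i - l))"
    by (rule sum.reindex_bij_witness[of _ "\<lambda>l. i - l" "\<lambda>k. i - k"]) auto
  also have "\<dots> = (\<Sum>l\<le>m. (-1)^(i - l - 1) * newton_e ps l * ps (i - l))"
    using less by (intro sum.mono_neutral_right) auto
  also have "\<dots> = (\<Sum>l\<le>m. (-1)^n * ((-1)^l * newton_e ps l * ps (i - l)))"
  proof (rule sum.cong[OF refl])
    fix l assume "l \<in> {..m}"
    then have "(-1)^(i - l - 1) = (-1)^n * (-1 :: 'f)^l"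
      using less.prems by (auto simp: n minus_one_power_iff)
    then show "(-1)^(i - l - 1) * newton_e ps l * ps (i - l) =
        (-1)^n * ((-1)^l * newton_e ps l * ps (i - l))"
      by simp
  qed
  also have "\<dots> = 0" using rec[OF less.prems] by (simp flip: sum_distrib_left)
  finally show ?case using n by (simp del: newton_e.simps of_nat_Suc)
qed

definition newton_fps :: "(nat \<Rightarrow> 'f::field) \<Rightarrow> 'f fps" where
  "newton_fps ps = Abs_fps (\<lambda>i. (-1)^i * newton_e ps i)"

lemma fps_XD_newton_fps:
  fixes ps :: "nat \<Rightarrow> 'f::field_char_0"
  shows "fps_XD (newton_fps ps) = - (Abs_fps (ps(0 := 0)) * newton_fps ps)"
proof (rule fps_ext)
  fix n
  show "fps_nth (fps_XD (newton_fps ps)) n = fps_nth (- (Abs_fps (ps(0 := 0)) * newton_fps ps)) n"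
  proof (cases n)
    case (Suc i)
    have "fps_nth (Abs_fps (ps(0 := 0)) * newton_fps ps) (Suc i) =
        (\<Sum>k\<in>{1..Suc i}. ps k * ((-1) ^ (Suc i - k) * newton_e ps (Suc i - k)))"
      by (simp add: fps_mult_nth newton_fps_def sum.atLeast_Suc_atMost[of 0])
    also have "\<dots> = (\<Sum>k\<in>{1..Suc i}. - ((-1) ^ Suc i) * ((-1)^(k-1) * newton_e ps (Suc i - k) * ps k))"
    proof (rule sum.cong[OF refl])
      fix k assume k: "k \<in> {1..Suc i}"
      then have "(-1) ^ (Suc i - k) = - ((-1) ^ Suc i) * ((-1 :: 'f) ^ (k - 1))"
        by (auto simp: uminus_power_if minus_one_power_iff)
      then show "ps k * ((-1) ^ (Suc i - k) * newton_e ps (Suc i - k)) =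
          - ((-1) ^ Suc i) * ((-1)^(k-1) * newton_e ps (Suc i - k) * ps k)"
        by (simp only: mult_ac)
    qed
    also have "\<dots> = - ((-1) ^ Suc i) * (of_nat (Suc i) * newton_e ps (Suc i))"
      unfolding newton_e_Suc_mult by (simp only: sum_distrib_left)
    finally show ?thesis
      using Suc by (simp add: newton_fps_def algebra_simps del: of_nat_Suc newton_e.simps)
  qed (simp add: fps_mult_nth)
qed

definition euler_deriv :: "'f::field_char_0 poly \<Rightarrow> 'f poly" where
  "euler_deriv p = pCons 0 (pderiv p)"

lemma coeff_euler_deriv: "coeff (euler_deriv p) n = of_nat n * coeff p n"
  by (cases n) (simp_all add: euler_deriv_def coeff_pderiv)

lemma euler_deriv_mult: "euler_deriv (p * q) = p * euler_deriv q + q * euler_deriv p"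
  by (simp add: euler_deriv_def pderiv_mult)

lemma euler_deriv_power: "p * euler_deriv (p ^ n) = of_nat n * (p ^ n * euler_deriv p)"
proof (cases n)
  case (Suc k)
  have "p * euler_deriv (p ^ n) = Polynomial.smult (of_nat n) (p ^ n * euler_deriv p)"
    by (simp add: euler_deriv_def Suc pderiv_power_Suc mult.assoc del: of_nat_Suc power_Suc)
      (simp add: mult.assoc)
  then show ?thesis by (simp add: of_nat_poly)
qed (simp add: euler_deriv_def)

lemma fps_of_poly_euler_deriv: "fps_of_poly (euler_deriv p) = fps_XD (fps_of_poly p)"
  by (rule fps_ext) (simp add: coeff_euler_deriv)

lemma euler_deriv_eq_mult_imp_0:
  assumes "euler_deriv H = H * K" "coeff H 0 \<noteq> 0"
  shows "K = 0"
proof (rule ccontr)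
  assume "K \<noteq> 0"
  have "H \<noteq> 0" using assms(2) by auto
  have "degree H + degree K = degree (euler_deriv H)"
    using \<open>H \<noteq> 0\<close> \<open>K \<noteq> 0\<close> by (simp add: assms(1) degree_mult_eq)
  also have "\<dots> \<le> degree H" by (intro degree_le) (simp add: coeff_euler_deriv coeff_eq_0)
  finally obtain c where c: "K = [:c:]" by (auto elim: degree_eq_zeroE)
  have "coeff H 0 * c = coeff (euler_deriv H) 0" by (simp add: assms(1) c)
  then show False using assms(2) \<open>K \<noteq> 0\<close> by (simp add: coeff_euler_deriv c)
qed

lemma maximal_power_factor:
  fixes g p :: "'a::field poly"
  assumes "\<not> is_unit g" "g \<noteq> 0" "p \<noteq> 0"
  obtains b H where "p = g ^ b * H" "\<not> g dvd H"
proof -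
  have "degree g > 0" using assms(1,2) is_unit_iff_degree by auto
  have "\<forall>b. g ^ b dvd p \<longrightarrow> b < Suc (degree p)"
  proof (intro allI impI)
    fix b assume "g ^ b dvd p"
    then have "b * degree g \<le> degree p"
      using dvd_imp_degree_le[OF _ assms(3)] assms(2) by (metis degree_power_eq)
    moreover have "b \<le> b * degree g" using \<open>degree g > 0\<close> by simp
    ultimately show "b < Suc (degree p)" by linarith
  qed
  moreover have "g ^ 0 dvd p" by simp
  ultimately obtain b where b: "g ^ b dvd p" and max: "\<And>c. g ^ c dvd p \<Longrightarrow> c \<le> b"
    using ex_has_greatest_nat[of "\<lambda>b. g ^ b dvd p" 0 "\<lambda>b. b"] by blast
  obtain H where H: "p = g ^ b * H" using b by (rule dvdE)
  have "\<not> g dvd H" using max[of "Suc b"] H by (auto simp: mult.assoc power_Suc2 simp del: power_Suc)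
  then show ?thesis using that H by blast
qed

text \<open>\<open>W\<close> is minus \<open>g\<close> times the logarithmic derivative of \<open>G = g^b H\<close>; the factor \<open>H\<close> prime to \<open>g\<close>
  contributes nothing, since it divides its own Euler derivative.\<close>
lemma log_derivative_prime_denominator:
  fixes g G W :: "'f::field_char_0 poly"
  assumes g: "prime_elem g" and G: "coeff G 0 \<noteq> 0"
    and ode: "g * euler_deriv G = - (G * W)"
  shows "\<exists>b. W = - (of_nat b * euler_deriv g)"
proof -
  have "G \<noteq> 0" "\<not> g dvd 1" "g \<noteq> 0" using G g by (auto simp: prime_elem_def)
  then obtain b H where bH: "G = g ^ b * H" "\<not> g dvd H"
    using maximal_power_factor by metis
  have "g ^ b * (of_nat b * euler_deriv g * H + g * euler_deriv H) = g * euler_deriv G"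
    by (simp add: bH(1) euler_deriv_mult distrib_left mult.left_commute[of g H] euler_deriv_power
        algebra_simps)
  also have "\<dots> = g ^ b * (- (H * W))" using ode by (simp add: bH(1) mult.assoc)
  finally have "of_nat b * euler_deriv g * H + g * euler_deriv H = - (H * W)"
    by (rule mult_left_cancel[THEN iffD1, rotated]) (simp add: \<open>g \<noteq> 0\<close>)
  then have factors: "g * euler_deriv H = H * (- W - of_nat b * euler_deriv g)"
    by (simp add: algebra_simps)
  then have "g dvd H * (- W - of_nat b * euler_deriv g)" by (metis dvd_triv_left)
  then have "g dvd - W - of_nat b * euler_deriv g"
    using g bH(2) by (simp add: prime_elem_dvd_mult_iff)
  then obtain K where K: "- W - of_nat b * euler_deriv g = g * K" by (rule dvdE)
  then have "g * euler_deriv H = g * (H * K)" using factors by (simp add: mult_ac)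
  then have "euler_deriv H = H * K" using \<open>g \<noteq> 0\<close> by simp
  moreover have "coeff H 0 \<noteq> 0" using G by (auto simp: bH(1) coeff_mult_0)
  ultimately have "K = 0" by (rule euler_deriv_eq_mult_imp_0)
  then have "- W = of_nat b * euler_deriv g" using K by simp
  then show ?thesis by (metis minus_minus)
qed

lemma fps_of_poly_truncate_fps:
  assumes "\<And>k. k \<ge> n \<Longrightarrow> fps_nth f k = 0"
  shows "fps_of_poly (truncate_fps n f) = f"
  using assms by (intro fps_ext) (simp add: coeff_truncate_fps)

lemma newton_log_derivative:
  fixes s :: "nat \<Rightarrow> 'f::field_char_0"
  assumes g: "prime_elem g" and G: "fps_of_poly G = newton_fps s"
    and V: "fps_of_poly V = fps_of_poly g * Abs_fps s"
  shows "\<exists>b. V = Polynomial.smult (s 0) g - of_nat b * euler_deriv g"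
proof -
  define W where "W = V - Polynomial.smult (s 0) g"
  have "Abs_fps s = Abs_fps (s(0 := 0)) + fps_const (s 0)"
    by (rule fps_ext) simp
  then have "fps_of_poly W = fps_of_poly g * Abs_fps (s(0 := 0))"
    by (simp add: W_def V fps_of_poly_diff fps_of_poly_smult distrib_left mult.commute)
  then have "fps_of_poly (g * euler_deriv G) = fps_of_poly (- (G * W))"
    by (simp add: fps_of_poly_mult fps_of_poly_uminus fps_of_poly_euler_deriv G
        fps_XD_newton_fps mult_ac)
  then have ode: "g * euler_deriv G = - (G * W)" by (simp only: fps_of_poly_eq_iff)
  have "coeff G 0 = 1" using arg_cong[OF G, of "\<lambda>f. fps_nth f 0"] by (simp add: newton_fps_def)
  then obtain b where "W = - (of_nat b * euler_deriv g)"
    using log_derivative_prime_denominator[OF g _ ode] by auto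
  then have "V = Polynomial.smult (s 0) g - of_nat b * euler_deriv g"
    unfolding W_def by (simp add: diff_eq_eq)
  then show ?thesis by blast
qed

lemma fps_nth_mult_recurrence:
  fixes g :: "'a::comm_semiring_1 poly"
  assumes "k \<ge> degree g"
  shows "fps_nth (fps_of_poly g * Abs_fps s) k = (\<Sum>i\<le>degree g. coeff g i * s (k - i))"
proof -
  have "fps_nth (fps_of_poly g * Abs_fps s) k = (\<Sum>i\<in>{0..k}. coeff g i * s (k - i))"
    by (simp add: fps_mult_nth)
  also have "\<dots> = (\<Sum>i\<le>degree g. coeff g i * s (k - i))"
    using assms by (intro sum.mono_neutral_right) (auto simp: coeff_eq_0)
  finally show ?thesis .
qed

text \<open>The recurrence makes \<open>g (\<Sum> s\<^sub>k X\<^sup>k)\<close> a polynomial.\<close>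
lemma power_sums_of_prime_recurrence:
  fixes s :: "nat \<Rightarrow> 'f::field_char_0"
  assumes g: "prime_elem g"
    and vanish: "\<And>i. i > m \<Longrightarrow> newton_e s i = 0"
    and rec: "\<And>k. k \<ge> degree g \<Longrightarrow> (\<Sum>i\<le>degree g. coeff g i * s (k - i)) = 0"
  shows "\<exists>b. s 0 = of_nat (b * degree g) \<and> s 1 * coeff g 0 = - of_nat b * coeff g 1"
proof -
  let ?f = "fps_of_poly g * Abs_fps s"
  define V where "V = truncate_fps (degree g) ?f"
  define G where "G = truncate_fps (Suc m) (newton_fps s)"
  have V: "fps_of_poly V = ?f"
    unfolding V_def by (intro fps_of_poly_truncate_fps) (simp add: fps_nth_mult_recurrence rec)
  have G: "fps_of_poly G = newton_fps s"
    unfolding G_def using vanish by (intro fps_of_poly_truncate_fps) (simp add: newton_fps_def)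
  obtain b where b: "V = Polynomial.smult (s 0) g - of_nat b * euler_deriv g"
    using newton_log_derivative[OF g G V] by blast
  have "fps_nth ?f k = coeff V k" for k by (simp flip: V)
  then have coeffs: "fps_nth ?f k = (s 0 - of_nat (b * k)) * coeff g k" for k
    by (simp add: b of_nat_poly coeff_euler_deriv left_diff_distrib mult.assoc)
  have "lead_coeff g \<noteq> 0" using g by (auto simp: prime_elem_def)
  then have "s 0 = of_nat (b * degree g)"
    using coeffs[of "degree g"] by (simp add: fps_nth_mult_recurrence rec)
  moreover have "s 1 * coeff g 0 = - of_nat b * coeff g 1"
    using coeffs[of 1] by (simp add: fps_mult_nth eq_neg_iff_add_eq_0 algebra_simps)
  ultimately show ?thesis by blast
qed

subsection \<open>Traces of operators on subspaces\<close>

locale central_algebra =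
  fixes \<phi> :: "'f::field_char_0 \<Rightarrow> 'v::ring_1"
  assumes phi_1: "\<phi> 1 = 1"
    and phi_add: "\<phi> (x + y) = \<phi> x + \<phi> y"
    and phi_mult: "\<phi> (x * y) = \<phi> x * \<phi> y"
    and phi_central: "\<phi> c * s = s * \<phi> c"
begin

abbreviation scale_by (infixr "*\<^sub>F" 75) where
  "c *\<^sub>F x \<equiv> fscale \<phi> c x"

sublocale vector_space "fscale \<phi>"
  by unfold_locales (simp_all add: fscale_def phi_1 phi_add phi_mult algebra_simps)

sublocale op: vector_space_pair "fscale \<phi>" "fscale \<phi>"
  by unfold_locales

sublocale form: vector_space_pair "fscale \<phi>" "(*) :: 'f \<Rightarrow> 'f \<Rightarrow> 'f"
  by unfold_locales (simp_all add: algebra_simps)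

abbreviation linear_op :: "('v \<Rightarrow> 'v) \<Rightarrow> bool" where
  "linear_op \<equiv> Vector_Spaces.linear (fscale \<phi>) (fscale \<phi>)"

abbreviation linear_form :: "('v \<Rightarrow> 'f) \<Rightarrow> bool" where
  "linear_form \<equiv> Vector_Spaces.linear (fscale \<phi>) (*)"

lemma scale_mult_left [simp]: "(c *\<^sub>F x) * y = c *\<^sub>F (x * y)"
  by (simp add: fscale_def mult.assoc)

lemma scale_mult_right [simp]: "x * (c *\<^sub>F y) = c *\<^sub>F (x * y)"
  by (metis fscale_def mult.assoc phi_central)

lemma phi_eq_scale: "\<phi> c = c *\<^sub>F 1"
  by (simp add: fscale_def)

lemma linear_op_iff:
  "linear_op L \<longleftrightarrow> (\<forall>x y. L (x + y) = L x + L y) \<and> (\<forall>c x. L (c *\<^sub>F x) = c *\<^sub>F L x)"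
  by (simp add: Vector_Spaces.linear_iff vector_space_axioms)

lemma linear_form_iff:
  "linear_form f \<longleftrightarrow> (\<forall>x y. f (x + y) = f x + f y) \<and> (\<forall>c x. f (c *\<^sub>F x) = c * f x)"
  by (simp add: Vector_Spaces.linear_iff vector_space_axioms form.vs2.vector_space_axioms)

lemma linear_op_mult [simp]:
  "linear_op ((*) a)" "linear_op (\<lambda>s. a * s * b)" "linear_op (\<lambda>s. s * b)"
  by (simp_all add: linear_op_iff algebra_simps)

lemma linear_op_compose: "linear_op L \<Longrightarrow> linear_op M \<Longrightarrow> linear_op (\<lambda>x. L (M x))"
  by (simp add: linear_op_iff)

lemma linear_op_span_stable:
  assumes "linear_op L" "L ` B \<subseteq> B" "x \<in> span B"
  shows "L x \<in> span B"
proof -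
  have "L x \<in> L ` span B" using assms(3) by (rule imageI)
  also have "\<dots> = span (L ` B)" by (rule op.linear_span_image[OF assms(1), symmetric])
  also have "\<dots> \<subseteq> span B" by (rule span_mono[OF assms(2)])
  finally show ?thesis .
qed

lemma linear_form_compose: "linear_form f \<Longrightarrow> linear_op L \<Longrightarrow> linear_form (\<lambda>x. f (L x))"
  by (simp add: linear_op_iff linear_form_iff)

lemma linear_form_lincomb:
  "linear_form f \<Longrightarrow> f (\<Sum>i\<in>I. c i *\<^sub>F v i) = (\<Sum>i\<in>I. c i * f (v i))"
  by (simp add: form.linear_sum form.linear_scale)

text \<open>Neither independence of the vectors nor duality of the forms is required.\<close>
definition frame :: "'v set \<Rightarrow> 'i set \<Rightarrow> ('i \<Rightarrow> 'v) \<Rightarrow> ('i \<Rightarrow> 'v \<Rightarrow> 'f) \<Rightarrow> bool" where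
  "frame V I v f \<longleftrightarrow> finite I \<and> (\<forall>i\<in>I. v i \<in> V \<and> linear_form (f i)) \<and>
     (\<forall>x\<in>V. (\<Sum>i\<in>I. f i x *\<^sub>F v i) = x)"

lemma frameD:
  assumes "frame V I v f"
  shows frame_finite: "finite I"
    and frame_in: "i \<in> I \<Longrightarrow> v i \<in> V"
    and frame_form: "i \<in> I \<Longrightarrow> linear_form (f i)"
    and frame_expand: "x \<in> V \<Longrightarrow> (\<Sum>i\<in>I. f i x *\<^sub>F v i) = x"
  using assms by (auto simp: frame_def)

lemma frame_expand_form:
  assumes "frame V I v f" "linear_form g" "x \<in> V"
  shows "(\<Sum>i\<in>I. f i x * g (v i)) = g x"
  using linear_form_lincomb[OF assms(2)] frame_expand[OF assms(1,3)] by metis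

lemma frame_expand_op:
  assumes "frame V I v f" "linear_op L" "x \<in> V"
  shows "(\<Sum>i\<in>I. f i x *\<^sub>F L (v i)) = L x"
  using op.linear_sum[OF assms(2), of "\<lambda>i. f i x *\<^sub>F v i" I] frame_expand[OF assms(1,3)]
  by (simp add: op.linear_scale[OF assms(2)])

lemma frame_image:
  assumes "frame V I v f" "linear_op J" "linear_op J'" "\<And>x. x \<in> V \<Longrightarrow> J' (J x) = x"
  shows "frame (J ` V) I (\<lambda>i. J (v i)) (\<lambda>i x. f i (J' x))"
  using assms(4) frameD[OF assms(1)]
  by (auto simp: frame_def frame_expand_op[OF assms(1,2)] linear_form_compose assms(3))

definition independent_family :: "'i set \<Rightarrow> ('i \<Rightarrow> 'v) \<Rightarrow> bool" where
  "independent_family I v \<longleftrightarrow> (\<forall>c. (\<Sum>i\<in>I. c i *\<^sub>F v i) = 0 \<longrightarrow> (\<forall>i\<in>I. c i = 0))"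

lemma independent_familyD:
  "independent_family I v \<Longrightarrow> (\<Sum>i\<in>I. c i *\<^sub>F v i) = 0 \<Longrightarrow> i \<in> I \<Longrightarrow> c i = 0"
  unfolding independent_family_def by blast

lemma independent_family_iff:
  assumes "finite I"
  shows "independent_family I v \<longleftrightarrow> inj_on v I \<and> independent (v ` I)"
proof (intro iffI conjI)
  assume indep: "independent_family I v"
  show inj: "inj_on v I"
  proof (rule inj_onI, rule ccontr)
    fix i k assume ik: "i \<in> I" "k \<in> I" "v i = v k" "i \<noteq> k"
    let ?c = "\<lambda>l. if l = i then 1 else if l = k then -1 else (0 :: 'f)"
    have "(\<Sum>l\<in>I. ?c l *\<^sub>F v l) = (\<Sum>l\<in>{i, k}. ?c l *\<^sub>F v l)"
      using assms ik by (intro sum.mono_neutral_right) auto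
    also have "\<dots> = 0" using ik by simp
    finally have "?c i = 0" by (rule independent_familyD[OF indep _ ik(1)])
    then show False by simp
  qed
  show "independent (v ` I)"
  proof
    assume "dependent (v ` I)"
    then obtain c i where c: "(\<Sum>x\<in>v ` I. c x *\<^sub>F x) = 0" "i \<in> I" "c (v i) \<noteq> 0"
      using dependent_finite[of "v ` I"] assms by auto
    then have "(\<Sum>i\<in>I. c (v i) *\<^sub>F v i) = 0" by (simp add: sum.reindex inj)
    then have "c (v i) = 0" using \<open>i \<in> I\<close> by (rule independent_familyD[OF indep])
    then show False using c(3) by contradiction
  qed
next
  assume inj_indep: "inj_on v I \<and> independent (v ` I)"
  show "independent_family I v"
    unfolding independent_family_def
  proof (intro allI impI ballI)
    fix c i assume c: "(\<Sum>i\<in>I. c i *\<^sub>F v i) = 0" and i: "i \<in> I"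
    have "(\<Sum>x\<in>v ` I. c (the_inv_into I v x) *\<^sub>F x) = 0"
      using inj_indep c by (simp add: sum.reindex the_inv_into_f_f)
    then have "c (the_inv_into I v (v i)) = 0"
      using inj_indep assms i by (intro independentD[of "v ` I" "v ` I"]) auto
    then show "c i = 0" using inj_indep i by (simp add: the_inv_into_f_f)
  qed
qed

lemma independent_family_ident: "finite B \<Longrightarrow> independent_family B (\<lambda>b. b) \<longleftrightarrow> independent B"
  by (simp add: independent_family_iff)

lemma frame_of_dual_forms:
  assumes "finite I" "\<And>i. i \<in> I \<Longrightarrow> linear_form (f i)"
    and dual: "\<And>i j. i \<in> I \<Longrightarrow> j \<in> I \<Longrightarrow> f i (v j) = (if i = j then 1 else 0)"
  shows "frame (span (v ` I)) I v f"
proof -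
  have "linear_op (\<lambda>x. \<Sum>i\<in>I. f i x *\<^sub>F v i)"
    using assms(2) by (simp add: linear_op_iff form.linear_add form.linear_scale
        scale_left_distrib sum.distrib scale_sum_right)
  moreover have "(\<Sum>i\<in>I. f i (v j) *\<^sub>F v i) = v j" if "j \<in> I" for j
  proof -
    have "(\<Sum>i\<in>I. f i (v j) *\<^sub>F v i) = (\<Sum>i\<in>I. if i = j then v j else 0)"
      using dual that by (intro sum.cong) auto
    then show ?thesis using assms(1) that by simp
  qed
  ultimately have "(\<Sum>i\<in>I. f i x *\<^sub>F v i) = x" if "x \<in> span (v ` I)" for x
    using op.linear_eq_on_span[OF _ linear_ident _ that, of "\<lambda>x. \<Sum>i\<in>I. f i x *\<^sub>F v i"] by auto
  then show ?thesis using assms(1,2) by (auto simp: frame_def intro: span_base)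
qed

lemma dual_forms_exist:
  assumes "finite I" "independent_family I v"
  obtains f where "\<And>i. i \<in> I \<Longrightarrow> linear_form (f i)"
    "\<And>i j. i \<in> I \<Longrightarrow> j \<in> I \<Longrightarrow> f i (v j) = (if i = j then 1 else 0)"
proof -
  have v: "inj_on v I" "independent (v ` I)" using assms independent_family_iff by auto
  have "\<exists>g. linear_form g \<and> (\<forall>x\<in>v ` I. g x = (if x = v i then 1 else 0))" for i
    by (rule form.linear_independent_extend[OF v(2)])
  then obtain f where "\<And>i. linear_form (f i)"
    "\<And>i x. x \<in> v ` I \<Longrightarrow> f i x = (if x = v i then 1 else 0)" by metis
  then show ?thesis using that[of f] inj_onD[OF v(1)] by (metis imageI)
qed

definition trace_on :: "'v set \<Rightarrow> ('v \<Rightarrow> 'v) \<Rightarrow> 'f" where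
  "trace_on V L = (let B = (SOME B. finite B \<and> independent B \<and> span B = V)
     in \<Sum>b\<in>B. representation B (L b) b)"

lemma lin_trace_eq: "lin_trace \<phi> L = trace_on UNIV L"
  by (simp add: lin_trace_def trace_on_def)

lemma frame_trace_eq:
  assumes W: "frame W I v f" and V: "frame V J w g" and "V \<subseteq> W"
    and L: "linear_op L" "\<And>x. x \<in> W \<Longrightarrow> L x \<in> V"
  shows "(\<Sum>i\<in>I. f i (L (v i))) = (\<Sum>j\<in>J. g j (L (w j)))"
proof -
  have "(\<Sum>i\<in>I. f i (L (v i))) = (\<Sum>i\<in>I. \<Sum>j\<in>J. g j (L (v i)) * f i (w j))"
    using frame_form[OF W] L(2) frame_in[OF W] by (simp add: frame_expand_form[OF V])
  also have "\<dots> = (\<Sum>j\<in>J. \<Sum>i\<in>I. f i (w j) * g j (L (v i)))"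
    by (subst sum.swap) (simp add: mult.commute)
  also have "\<dots> = (\<Sum>j\<in>J. g j (L (w j)))"
  proof (rule sum.cong[OF refl])
    fix j assume j: "j \<in> J"
    show "(\<Sum>i\<in>I. f i (w j) * g j (L (v i))) = g j (L (w j))"
      by (rule frame_expand_form[OF W linear_form_compose[OF frame_form[OF V j] L(1)]])
        (use \<open>V \<subseteq> W\<close> frame_in[OF V j] in auto)
  qed
  finally show ?thesis .
qed

end

locale fd_central_algebra =
  central_algebra \<phi> + finite_dimensional_vector_space "fscale \<phi>" Basis
  for \<phi> :: "'f::field_char_0 \<Rightarrow> 'v::ring_1" and Basis :: "'v set"
begin

sublocale op: finite_dimensional_vector_space_pair_1 "fscale \<phi>" Basis "fscale \<phi>"
  by unfold_locales

declare dim_UNIV [simp del] dim_eq_0 [simp del]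

lemma independent_family_card_le_dim:
  assumes "finite I" "independent_family I v"
  shows "card I \<le> dim UNIV"
proof -
  have "inj_on v I" "independent (v ` I)" using assms independent_family_iff by auto
  then show ?thesis using independent_card_le_dim[of "v ` I" UNIV] by (simp add: card_image)
qed

lemma dim_span_independent_family:
  assumes "finite I" "independent_family I v"
  shows "dim (span (v ` I)) = card I"
  using assms dim_span_eq_card_independent card_image by (metis independent_family_iff)

lemma dual_basis_exists:
  assumes "independent B"
  obtains f where "frame (span B) B (\<lambda>b. b) f"
    "\<And>b c. b \<in> B \<Longrightarrow> c \<in> B \<Longrightarrow> f b c = (if b = c then 1 else 0)"
proof -
  have B: "finite B" using assms by (rule finiteI_independent)
  obtain f where "\<And>b. b \<in> B \<Longrightarrow> linear_form (f b)"
    "\<And>b c. b \<in> B \<Longrightarrow> c \<in> B \<Longrightarrow> f b c = (if b = c then 1 else 0)"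
    using dual_forms_exist[of B "\<lambda>b. b"] B assms independent_family_ident by metis
  then show ?thesis using that[of f] frame_of_dual_forms[OF B, of f "\<lambda>b. b"] by simp
qed

lemma basis_frame_exists:
  assumes "subspace V"
  obtains B :: "'v set" and f where "frame V B (\<lambda>b. b) f" "card B = dim V"
    "\<And>b c. b \<in> B \<Longrightarrow> c \<in> B \<Longrightarrow> f b c = (if b = c then 1 else 0)"
  using basis_subspace_exists[OF assms] dual_basis_exists that by metis

lemma trace_on_basis:
  assumes "subspace V"
  obtains B where "finite B" "independent B" "span B = V"
    "\<And>L. trace_on V L = (\<Sum>b\<in>B. representation B (L b) b)"
proof -
  define B where "B = (SOME B. finite B \<and> independent B \<and> span B = V)"
  have "\<exists>B. finite B \<and> independent B \<and> span B = V"
    using basis_subspace_exists[OF assms] by metis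
  then have "finite B \<and> independent B \<and> span B = V"
    unfolding B_def by (rule someI_ex)
  then show ?thesis using that[of B] by (simp add: trace_on_def flip: B_def)
qed

lemma trace_on_frame:
  assumes V: "subspace V" and fr: "frame V I v f"
    and L: "linear_op L" "\<And>x. x \<in> V \<Longrightarrow> L x \<in> V"
  shows "trace_on V L = (\<Sum>i\<in>I. f i (L (v i)))"
proof -
  obtain B where B: "finite B" "independent B" "span B = V"
    "\<And>L. trace_on V L = (\<Sum>b\<in>B. representation B (L b) b)"
    using trace_on_basis[OF V] by metis
  obtain g where g: "frame V B (\<lambda>b. b) g" "\<And>b c. b \<in> B \<Longrightarrow> c \<in> B \<Longrightarrow> g b c = (if b = c then 1 else 0)"
    using dual_basis_exists[OF B(2)] B(3) by metis
  have "representation B x b = g b x" if b: "b \<in> B" and x: "x \<in> V" for b x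
  proof -
    have "g b x = g b (\<Sum>c\<in>B. representation B x c *\<^sub>F c)"
      using B x by (simp add: sum_representation_eq)
    also have "\<dots> = (\<Sum>c\<in>B. if c = b then representation B x c else 0)"
      unfolding linear_form_lincomb[OF frame_form[OF g(1) b]]
      using g(2)[OF b] by (intro sum.cong) auto
    finally show ?thesis using B(1) b by simp
  qed
  then have "trace_on V L = (\<Sum>b\<in>B. g b (L b))"
    using B(4)[of L] L(2) frame_in[OF g(1)] by simp
  also have "\<dots> = (\<Sum>i\<in>I. f i (L (v i)))"
    by (rule frame_trace_eq[OF g(1) fr order_refl L])
  finally show ?thesis .
qed

lemma trace_on_cong:
  assumes "subspace V" "\<And>x. x \<in> V \<Longrightarrow> L x = M x"
  shows "trace_on V L = trace_on V M"
proof -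
  obtain B where B: "span B = V" "\<And>L. trace_on V L = (\<Sum>b\<in>B. representation B (L b) b)"
    using trace_on_basis[OF assms(1)] by metis
  then show ?thesis using assms(2) span_base[of _ B] by simp
qed

lemma trace_on_image:
  assumes V: "subspace V" and W: "subspace W" and "V \<subseteq> W"
    and L: "linear_op L" "\<And>x. x \<in> W \<Longrightarrow> L x \<in> V" and M: "\<And>x. x \<in> V \<Longrightarrow> L x = M x"
  shows "trace_on W L = trace_on V M"
proof -
  obtain B :: "'v set" and f where B: "frame V B (\<lambda>b. b) f" by (rule basis_frame_exists[OF V])
  obtain C :: "'v set" and g where C: "frame W C (\<lambda>b. b) g" by (rule basis_frame_exists[OF W])
  have "trace_on W L = (\<Sum>c\<in>C. g c (L c))"
    using \<open>V \<subseteq> W\<close> L by (intro trace_on_frame[OF W C]) auto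
  also have "\<dots> = (\<Sum>b\<in>B. f b (L b))"
    by (rule frame_trace_eq[OF C B \<open>V \<subseteq> W\<close> L])
  also have "\<dots> = trace_on V L"
    using \<open>V \<subseteq> W\<close> L by (intro trace_on_frame[OF V B, symmetric]) auto
  also have "\<dots> = trace_on V M" by (rule trace_on_cong[OF V M])
  finally show ?thesis .
qed

lemma trace_on_scalar:
  assumes V: "subspace V" and L: "\<And>x. x \<in> V \<Longrightarrow> L x = c *\<^sub>F x"
  shows "trace_on V L = c * of_nat (dim V)"
proof -
  obtain B :: "'v set" and f where B: "frame V B (\<lambda>b. b) f" "card B = dim V"
    "\<And>b b'. b \<in> B \<Longrightarrow> b' \<in> B \<Longrightarrow> f b b' = (if b = b' then 1 else 0)"
    using basis_frame_exists[OF V] by metis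
  have "trace_on V L = trace_on V (\<lambda>x. c *\<^sub>F x)" by (rule trace_on_cong[OF V L])
  also have "\<dots> = (\<Sum>b\<in>B. f b (c *\<^sub>F b))"
    by (intro trace_on_frame[OF V B(1)] linear_scale_self subspace_scale[OF V])
  also have "\<dots> = (\<Sum>b\<in>B. c)"
    using B(3) frame_form[OF B(1)] by (intro sum.cong) (auto simp: form.linear_scale)
  finally show ?thesis using B(2) by (simp add: mult.commute)
qed

lemma trace_on_scalar_image:
  assumes "subspace V" "subspace W" "V \<subseteq> W"
    and "linear_op L" "\<And>x. x \<in> W \<Longrightarrow> L x \<in> V" "\<And>x. x \<in> V \<Longrightarrow> L x = c *\<^sub>F x"
  shows "trace_on W L = c * of_nat (dim V)"
  using trace_on_image[OF assms(1-5), of L] trace_on_scalar[OF assms(1,6)] by simp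

lemma trace_on_direct_sum:
  assumes U: "subspace U" and W: "subspace W" and disj: "U \<inter> W = {0}"
    and L: "linear_op L" "\<And>x. x \<in> U \<Longrightarrow> L x \<in> U" "\<And>x. x \<in> W \<Longrightarrow> L x \<in> W"
  shows "trace_on (span (U \<union> W)) L = trace_on U L + trace_on W L"
proof -
  obtain B where B: "finite B" "independent B" "span B = U" "card B = dim U"
    using basis_subspace_exists[OF U] by metis
  obtain C where C: "finite C" "independent C" "span C = W" "card C = dim W"
    using basis_subspace_exists[OF W] by metis
  have span: "span (B \<union> C) = span (U \<union> W)"
    unfolding span_Un using B(3) C(3) U W by (simp add: span_eq_iff[THEN iffD2])
  have "card (B \<union> C) \<le> dim (span (B \<union> C))"
    using dim_sums_Int[OF U W] disj B(3,4) C(3,4) card_Un_le[of B C]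
    by (simp add: span_Un del: dim_span)
  then have indep: "independent (B \<union> C)"
    using B(1) C(1) by (intro card_le_dim_spanning[OF span_superset order_refl]) auto
  have "B \<inter> C \<subseteq> U \<inter> W" using span_superset B(3) C(3) by blast
  moreover have "0 \<notin> B" using indep dependent_zero by blast
  ultimately have "B \<inter> C = {}" unfolding disj by auto
  obtain f where fr: "frame (span (B \<union> C)) (B \<union> C) (\<lambda>b. b) f"
    and dual: "\<And>b c. b \<in> B \<union> C \<Longrightarrow> c \<in> B \<union> C \<Longrightarrow> f b c = (if b = c then 1 else 0)"
    using dual_basis_exists[OF indep] by blast
  have "frame (span D) D (\<lambda>b. b) f" if "D \<subseteq> B \<union> C" for D
    using frame_of_dual_forms[of D f "\<lambda>b. b"] that finite_subset[OF that] B(1) C(1)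
      frame_form[OF fr] dual by (simp add: subset_iff)
  then have "frame U B (\<lambda>b. b) f" "frame W C (\<lambda>b. b) f" using B(3) C(3) by blast+
  then have "trace_on U L = (\<Sum>b\<in>B. f b (L b))" "trace_on W L = (\<Sum>c\<in>C. f c (L c))"
    using L by (simp_all add: trace_on_frame U W)
  moreover have "trace_on (span (U \<union> W)) L = (\<Sum>b\<in>B \<union> C. f b (L b))"
  proof (rule trace_on_frame[OF subspace_span _ L(1)])
    show "L x \<in> span (U \<union> W)" if "x \<in> span (U \<union> W)" for x
      using L(2,3) that by (intro linear_op_span_stable[OF L(1)]) auto
  qed (use fr span in simp)
  ultimately show ?thesis
    using B(1) C(1) \<open>B \<inter> C = {}\<close> by (simp add: sum.union_disjoint)
qed

lemma trace_on_inj_image: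
  assumes V: "subspace V" and J: "linear_op J" "inj_on J V"
    and L: "linear_op L" and M: "linear_op M" "\<And>x. x \<in> V \<Longrightarrow> M x \<in> V"
    and LJ: "\<And>x. x \<in> V \<Longrightarrow> L (J x) = J (M x)"
  shows "trace_on (J ` V) L = trace_on V M"
proof -
  obtain J' where J': "linear_op J'" "\<And>x. x \<in> V \<Longrightarrow> J' (J x) = x"
    using op.linear_exists_left_inverse_on[OF J(1) V J(2)] by blast
  obtain B :: "'v set" and f where B: "frame V B (\<lambda>b. b) f" by (rule basis_frame_exists[OF V])
  have "trace_on (J ` V) L = (\<Sum>b\<in>B. f b (J' (L (J b))))"
    using LJ M(2) op.linear_subspace_image[OF J(1) V]
    by (intro trace_on_frame frame_image[OF B J(1) J'] L) auto
  also have "\<dots> = (\<Sum>b\<in>B. f b (M b))"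
    using LJ J'(2) M(2) frame_in[OF B] by (intro sum.cong) auto
  also have "\<dots> = trace_on V M" by (rule trace_on_frame[OF V B M, symmetric])
  finally show ?thesis .
qed

lemma trace_on_sum:
  assumes V: "subspace V" and L: "\<And>i. i \<in> I \<Longrightarrow> linear_op (L i)"
    "\<And>i x. i \<in> I \<Longrightarrow> x \<in> V \<Longrightarrow> L i x \<in> V"
  shows "trace_on V (\<lambda>x. \<Sum>i\<in>I. L i x) = (\<Sum>i\<in>I. trace_on V (L i))"
proof -
  obtain B :: "'v set" and f where B: "frame V B (\<lambda>b. b) f" by (rule basis_frame_exists[OF V])
  have "trace_on V (\<lambda>x. \<Sum>i\<in>I. L i x) = (\<Sum>b\<in>B. f b (\<Sum>i\<in>I. L i b))"
    using L by (intro trace_on_frame[OF V B] op.linear_compose_sum subspace_sum[OF V]) auto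
  also have "\<dots> = (\<Sum>i\<in>I. \<Sum>b\<in>B. f b (L i b))"
    by (subst sum.swap) (simp add: form.linear_sum[OF frame_form[OF B]])
  also have "\<dots> = (\<Sum>i\<in>I. trace_on V (L i))"
    using L by (intro sum.cong refl trace_on_frame[OF V B, symmetric]) auto
  finally show ?thesis .
qed

lemma trace_on_commute:
  assumes V: "subspace V" and L: "linear_op L" "\<And>x. x \<in> V \<Longrightarrow> L x \<in> V"
    and M: "linear_op M" "\<And>x. x \<in> V \<Longrightarrow> M x \<in> V"
  shows "trace_on V (\<lambda>x. L (M x)) = trace_on V (\<lambda>x. M (L x))"
proof -
  obtain B :: "'v set" and f where B: "frame V B (\<lambda>b. b) f" by (rule basis_frame_exists[OF V])
  have trace: "trace_on V (\<lambda>x. L (M x)) = (\<Sum>b\<in>B. \<Sum>c\<in>B. f c (M b) * f b (L c))"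
    if "linear_op L" "\<And>x. x \<in> V \<Longrightarrow> L x \<in> V" "linear_op M" "\<And>x. x \<in> V \<Longrightarrow> M x \<in> V" for L M
  proof -
    have "trace_on V (\<lambda>x. L (M x)) = (\<Sum>b\<in>B. f b (L (M b)))"
      by (rule trace_on_frame[OF V B linear_op_compose[OF that(1,3)]]) (rule that(2)[OF that(4)])
    also have "\<dots> = (\<Sum>b\<in>B. \<Sum>c\<in>B. f c (M b) * f b (L c))"
    proof (rule sum.cong[OF refl])
      fix b assume b: "b \<in> B"
      show "f b (L (M b)) = (\<Sum>c\<in>B. f c (M b) * f b (L c))"
        by (rule frame_expand_form[OF B linear_form_compose[OF frame_form[OF B b] that(1)]
              that(4)[OF frame_in[OF B b]], symmetric])
    qed
    finally show ?thesis .
  qed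
  have "trace_on V (\<lambda>x. L (M x)) = (\<Sum>b\<in>B. \<Sum>c\<in>B. f c (M b) * f b (L c))"
    by (rule trace[OF L M])
  also have "\<dots> = (\<Sum>b\<in>B. \<Sum>c\<in>B. f c (L b) * f b (M c))"
    by (subst sum.swap) (simp add: mult.commute)
  also have "\<dots> = trace_on V (\<lambda>x. M (L x))"
    by (rule trace[OF M L, symmetric])
  finally show ?thesis .
qed

subsection \<open>The regular trace and domain subalgebras\<close>

definition regular_trace :: "'v set \<Rightarrow> 'v \<Rightarrow> 'f" where
  "regular_trace E a = trace_on E ((*) a)"

abbreviation full_trace :: "'v \<Rightarrow> 'f" ("\<T>") where
  "\<T> \<equiv> regular_trace UNIV"

lemma linear_form_full_trace: "linear_form \<T>"
proof -
  obtain B :: "'v set" and f where B: "frame UNIV B (\<lambda>b. b) f"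
    by (rule basis_frame_exists[OF subspace_UNIV])
  have "\<T> = (\<lambda>x. \<Sum>b\<in>B. f b (x * b))"
    unfolding regular_trace_def by (intro ext trace_on_frame[OF subspace_UNIV B]) simp_all
  then show ?thesis
    using linear_form_compose[OF frame_form[OF B] linear_op_mult(3)]
    by (simp add: form.linear_compose_sum)
qed

lemmas full_trace_linear = form.linear_0[OF linear_form_full_trace]
  form.linear_add[OF linear_form_full_trace]
  form.linear_diff[OF linear_form_full_trace] form.linear_scale[OF linear_form_full_trace]
  form.linear_sum[OF linear_form_full_trace]

lemma full_trace_commute: "\<T> (x * y) = \<T> (y * x)"
  using trace_on_commute[OF subspace_UNIV linear_op_mult(1) _ linear_op_mult(1), of x y]
  by (simp add: regular_trace_def flip: mult.assoc)

lemma full_trace_1: "\<T> 1 = of_nat (dim UNIV)"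
  using trace_on_scalar[of UNIV "(*) 1" 1] by (simp add: regular_trace_def)

lemma idempotent_lmult:
  fixes e :: 'v
  assumes "e * e = e" "v \<in> range ((*) e)"
  shows "e * v = v"
proof -
  obtain s where s: "v = e * s" using assms(2) by blast
  then have "e * v = e * e * s" by (simp add: mult.assoc)
  then show ?thesis by (simp only: assms(1) s)
qed

lemma full_trace_mult_idempotent:
  assumes e: "e * e = e" and x: "x * e = e * x"
  shows "\<T> (x * e) = trace_on (range ((*) e)) ((*) x)"
  unfolding regular_trace_def
proof (rule trace_on_image)
  show "subspace (range ((*) e))"
    by (rule op.linear_subspace_image[OF linear_op_mult(1) subspace_UNIV])
  show "x * e * s \<in> range ((*) e)" for s
    unfolding x mult.assoc by (rule rangeI)
  show "x * e * s = x * s" if "s \<in> range ((*) e)" for s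
    using idempotent_lmult[OF e that] by (simp add: mult.assoc)
qed simp_all

lemma full_trace_idempotent:
  assumes "e * e = e"
  shows "\<T> e = of_nat (dim (range ((*) e)))"
proof -
  have "\<T> (1 * e) = trace_on (range ((*) e)) ((*) 1)"
    by (rule full_trace_mult_idempotent[OF assms]) simp
  also have "\<dots> = 1 * of_nat (dim (range ((*) e)))"
    by (rule trace_on_scalar[OF op.linear_subspace_image[OF linear_op_mult(1) subspace_UNIV]]) simp
  finally show ?thesis by simp
qed

definition domain_subalgebra :: "'v set \<Rightarrow> 'v \<Rightarrow> bool" where
  "domain_subalgebra E e \<longleftrightarrow> subspace E \<and> e \<in> E \<and> e \<noteq> 0 \<and> (\<forall>x\<in>E. e * x = x \<and> x * e = x) \<and>
     (\<forall>x\<in>E. \<forall>y\<in>E. x * y \<in> E) \<and> (\<forall>x\<in>E. \<forall>y\<in>E. x * y = 0 \<longrightarrow> x = 0 \<or> y = 0)"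

lemma domain_subalgebraD:
  assumes "domain_subalgebra E e"
  shows domain_subspace: "subspace E"
    and domain_unit: "e \<in> E" "e \<noteq> 0"
    and domain_unit_left: "x \<in> E \<Longrightarrow> e * x = x"
    and domain_unit_right: "x \<in> E \<Longrightarrow> x * e = x"
    and domain_mult: "x \<in> E \<Longrightarrow> y \<in> E \<Longrightarrow> x * y \<in> E"
    and domain_mult_eq_0: "x \<in> E \<Longrightarrow> y \<in> E \<Longrightarrow> x * y = 0 \<Longrightarrow> x = 0 \<or> y = 0"
  using assms unfolding domain_subalgebra_def by blast+

lemma linear_op_inj_imp_surj_on:
  assumes L: "linear_op L" and V: "subspace V"
    and "\<And>x. x \<in> V \<Longrightarrow> L x \<in> V" "\<And>x. x \<in> V \<Longrightarrow> L x = 0 \<Longrightarrow> x = 0"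
  shows "L ` V = V"
proof (rule subspace_dim_equal[OF op.linear_subspace_image[OF L V] V])
  have "inj_on L V" using op.linear_inj_on_iff_eq_0[OF L V] assms(4) by blast
  then show "dim V \<le> dim (L ` V)"
    using op.dim_image_eq[OF L, of V] V by (simp add: span_eq_iff[THEN iffD2])
qed (use assms(3) in auto)

lemma domain_inverse_exists:
  assumes E: "domain_subalgebra E e" and x: "x \<in> E" "x \<noteq> 0"
  obtains y where "y \<in> E" "x * y = e" "y * x = e"
proof -
  have "(*) x ` E = E"
    using x domain_mult[OF E] domain_mult_eq_0[OF E]
    by (intro linear_op_inj_imp_surj_on domain_subspace[OF E]) auto
  then obtain y where y: "y \<in> E" "x * y = e"
    using domain_unit(1)[OF E] by (metis imageE)
  have "x * (y * x - e) = 0"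
    using y x(1) by (simp add: right_diff_distrib domain_unit_left[OF E] domain_unit_right[OF E]
        flip: mult.assoc)
  moreover have "y * x - e \<in> E"
    by (rule subspace_diff[OF domain_subspace[OF E] domain_mult[OF E y(1) x(1)]
          domain_unit(1)[OF E]])
  ultimately have "y * x = e" using domain_mult_eq_0[OF E] x by fastforce
  then show ?thesis using that y by blast
qed

lemma regular_trace_unit:
  assumes "domain_subalgebra E e"
  shows "regular_trace E e = of_nat (dim E)"
  unfolding regular_trace_def
  using trace_on_scalar[OF domain_subspace[OF assms], of "(*) e" 1] domain_unit_left[OF assms]
  by simp

definition left_stable :: "'v set \<Rightarrow> 'v set \<Rightarrow> bool" where
  "left_stable E V \<longleftrightarrow> subspace V \<and> (\<forall>x\<in>E. \<forall>v\<in>V. x * v \<in> V)"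

lemma left_stable_cyclic:
  assumes E: "domain_subalgebra E e"
  shows "left_stable E ((\<lambda>y. y * v) ` E)"
  using op.linear_subspace_image[OF linear_op_mult(3) domain_subspace[OF E], of v] domain_mult[OF E]
  by (auto simp: left_stable_def simp flip: mult.assoc)

lemma left_stable_sum:
  assumes "left_stable E U" "left_stable E W"
  shows "left_stable E (span (U \<union> W))"
  unfolding left_stable_def
proof (intro conjI ballI)
  fix x v assume "x \<in> E" "v \<in> span (U \<union> W)"
  then show "x * v \<in> span (U \<union> W)"
    using assms by (intro linear_op_span_stable[OF linear_op_mult(1)]) (auto simp: left_stable_def)
qed (rule subspace_span)

lemma cyclic_disjoint:
  assumes E: "domain_subalgebra E e" and U: "left_stable E U" and v: "v \<notin> U" "e * v = v"
    and x: "x \<in> E" "x * v \<in> U"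
  shows "x = 0"
proof (rule ccontr)
  assume "x \<noteq> 0"
  then obtain y where "y \<in> E" "y * x = e" by (rule domain_inverse_exists[OF E x(1)])
  then have "y * (x * v) = v" using v(2) by (simp flip: mult.assoc)
  then show False using U x(2) v(1) \<open>y \<in> E\<close> by (metis left_stable_def)
qed

lemma trace_on_add_cyclic:
  assumes E: "domain_subalgebra E e" and U: "left_stable E U" and v: "v \<notin> U" "e * v = v"
    and x: "x \<in> E"
  shows "trace_on (span (U \<union> (\<lambda>y. y * v) ` E)) ((*) x) =
    trace_on U ((*) x) + regular_trace E x"
proof -
  let ?W = "(\<lambda>y. y * v) ` E"
  have subspaces: "subspace U" "subspace ?W"
    using U left_stable_cyclic[OF E] by (simp_all add: left_stable_def)
  have "U \<inter> ?W = {0}"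
    using cyclic_disjoint[OF E U v] subspaces[THEN subspace_0] by fastforce
  then have "trace_on (span (U \<union> ?W)) ((*) x) = trace_on U ((*) x) + trace_on ?W ((*) x)"
    using U x left_stable_cyclic[OF E, of v]
    by (intro trace_on_direct_sum subspaces) (auto simp: left_stable_def)
  moreover have "trace_on ?W ((*) x) = trace_on E ((*) x)"
  proof (rule trace_on_inj_image[OF domain_subspace[OF E]])
    show "inj_on (\<lambda>y. y * v) E"
      unfolding op.linear_inj_on_iff_eq_0[OF linear_op_mult(3) domain_subspace[OF E]]
      using cyclic_disjoint[OF E U v] subspace_0[OF subspaces(1)] by auto
  qed (use x domain_mult[OF E] in \<open>simp_all add: mult.assoc\<close>)
  ultimately show ?thesis by (simp add: regular_trace_def)
qed

definition isotypic :: "'v set \<Rightarrow> 'v set \<Rightarrow> bool" where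
  "isotypic E U \<longleftrightarrow> left_stable E U \<and>
     (\<exists>n. \<forall>x\<in>E. trace_on U ((*) x) = of_nat n * regular_trace E x)"

lemma isotypic_zero: "isotypic E {0}"
proof -
  have "trace_on {0} ((*) x) = 0" for x
    using trace_on_scalar[OF subspace_single_0, of "(*) x" 0] by simp
  then show ?thesis by (auto simp: isotypic_def left_stable_def intro!: exI[of _ 0])
qed

lemma isotypic_add_cyclic:
  assumes E: "domain_subalgebra E e" and U: "isotypic E U" and v: "v \<notin> U" "e * v = v"
  shows "isotypic E (span (U \<union> (\<lambda>y. y * v) ` E))"
proof -
  have stable: "left_stable E U" using U by (simp add: isotypic_def)
  obtain n where "\<And>x. x \<in> E \<Longrightarrow> trace_on U ((*) x) = of_nat n * regular_trace E x"
    using U by (auto simp: isotypic_def)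
  then have "trace_on (span (U \<union> (\<lambda>y. y * v) ` E)) ((*) x) =
      of_nat (Suc n) * regular_trace E x" if "x \<in> E" for x
    using trace_on_add_cyclic[OF E stable v that] that by (simp add: algebra_simps)
  then show ?thesis
    using left_stable_sum[OF stable left_stable_cyclic[OF E]] unfolding isotypic_def by blast
qed

text \<open>Modules over the division algebra \<open>E\<close> are free: peel off copies \<open>E v\<close> of the regular module.\<close>
lemma trace_on_module:
  assumes E: "domain_subalgebra E e" and V: "left_stable E V" and unital: "\<And>v. v \<in> V \<Longrightarrow> e * v = v"
  shows "\<exists>n. \<forall>x\<in>E. trace_on V ((*) x) = of_nat n * regular_trace E x"
proof -
  let ?P = "\<lambda>U. isotypic E U \<and> U \<subseteq> V"
  have "?P {0}" using V isotypic_zero by (auto simp: left_stable_def subspace_0)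
  moreover have "\<forall>U. ?P U \<longrightarrow> dim U < Suc (dim V)" using dim_subset by (auto simp: less_Suc_eq_le)
  ultimately obtain U where U: "isotypic E U" "U \<subseteq> V"
    and max: "\<And>W. isotypic E W \<Longrightarrow> W \<subseteq> V \<Longrightarrow> dim W \<le> dim U"
    using ex_has_greatest_nat[of ?P "{0}" dim "Suc (dim V)"] by blast
  have "U = V"
  proof (rule ccontr)
    assume "U \<noteq> V"
    then obtain v where v: "v \<in> V" "v \<notin> U" using U(2) by blast
    let ?W = "span (U \<union> (\<lambda>y. y * v) ` E)"
    have W: "isotypic E ?W" by (rule isotypic_add_cyclic[OF E U(1) v(2) unital[OF v(1)]])
    have "?W \<subseteq> V" using U(2) V v(1) by (intro span_minimal) (auto simp: left_stable_def)
    then have "dim ?W \<le> dim U" by (rule max[OF W])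
    moreover have "subspace U" using U(1) by (simp add: isotypic_def left_stable_def)
    ultimately have "U = ?W" by (intro subspace_dim_equal subspace_span) (auto intro: span_base)
    moreover have "e * v \<in> ?W" using domain_unit(1)[OF E] by (intro span_base) blast
    ultimately show False using unital[OF v(1)] v(2) by simp
  qed
  then show ?thesis using U by (simp add: isotypic_def)
qed

lemma left_stable_range:
  assumes "\<And>x. x \<in> E \<Longrightarrow> x * e = e * x"
  shows "left_stable E (range ((*) e))"
  unfolding left_stable_def
proof (intro conjI ballI)
  show "subspace (range ((*) e))"
    by (rule op.linear_subspace_image[OF linear_op_mult(1) subspace_UNIV])
  fix x v assume "x \<in> E" "v \<in> range ((*) e)"
  then obtain s where "x * v = e * (x * s)" by (metis assms mult.assoc imageE)
  then show "x * v \<in> range ((*) e)" by blast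
qed

lemma full_trace_mult_idempotent_domain:
  assumes E: "domain_subalgebra E u" and e: "e * e = e"
    and comm: "\<And>x. x \<in> E \<Longrightarrow> x * e = e * x" and unital: "u * e = e"
  shows "\<exists>n. \<forall>x\<in>E. \<T> (x * e) = of_nat n * regular_trace E x"
proof -
  have "u * v = v" if "v \<in> range ((*) e)" for v
    using that unital by (metis imageE mult.assoc)
  then show ?thesis
    using trace_on_module[OF E left_stable_range[OF comm]]
    by (simp add: full_trace_mult_idempotent[OF e comm])
qed

lemma full_trace_on_domain:
  assumes E: "domain_subalgebra E e"
  shows "\<exists>n. \<forall>x\<in>E. \<T> x = of_nat n * regular_trace E x"
proof -
  have e: "e * e = e" using domain_unit_left[OF E domain_unit(1)[OF E]] .
  have "\<exists>n. \<forall>x\<in>E. \<T> (x * e) = of_nat n * regular_trace E x"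
    by (rule full_trace_mult_idempotent_domain[OF E e _ e])
      (simp add: domain_unit_left[OF E] domain_unit_right[OF E])
  then show ?thesis by (simp add: domain_unit_right[OF E])
qed

subsection \<open>Dual bases and Casimir operators\<close>

definition nondegenerate_on :: "'v set \<Rightarrow> bool" where
  "nondegenerate_on V \<longleftrightarrow> (\<forall>a\<in>V. (\<forall>x\<in>V. \<T> (a * x) = 0) \<longrightarrow> a = 0)"

lemma nondegenerateD: "nondegenerate_on V \<Longrightarrow> a \<in> V \<Longrightarrow> (\<And>x. x \<in> V \<Longrightarrow> \<T> (a * x) = 0) \<Longrightarrow> a = 0"
  by (simp add: nondegenerate_on_def)

lemma nondegenerate_eqI:
  assumes "nondegenerate_on V" "subspace V" "a \<in> V" "b \<in> V" "\<And>x. x \<in> V \<Longrightarrow> \<T> (a * x) = \<T> (b * x)"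
  shows "a = b"
  using nondegenerateD[OF assms(1) subspace_diff[OF assms(2-4)]] assms(5)
  by (simp add: left_diff_distrib full_trace_linear)

definition dual_bases :: "'v set \<Rightarrow> 'i set \<Rightarrow> ('i \<Rightarrow> 'v) \<Rightarrow> ('i \<Rightarrow> 'v) \<Rightarrow> bool" where
  "dual_bases V I a b \<longleftrightarrow> (\<forall>i\<in>I. a i \<in> V) \<and> frame V I b (\<lambda>i x. \<T> (a i * x))"

lemma linear_form_trace_mult: "linear_form (\<lambda>x. \<T> (a * x))" "linear_form (\<lambda>x. \<T> (x * a))"
  by (rule linear_form_compose[OF linear_form_full_trace]; simp)+

lemma dual_bases_exist:
  assumes V: "subspace V" and nondeg: "nondegenerate_on V"
  obtains B :: "'v set" and a where "dual_bases V B a (\<lambda>b. b)"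
proof -
  obtain B where B: "finite B" "independent B" "span B = V" "B \<subseteq> V"
    using basis_subspace_exists[OF V] by metis
  have coeff_0: "c b = 0" if "(\<Sum>b\<in>B. c b *\<^sub>F b) = 0" "b \<in> B" for b c
    using independentD[OF B(2,1) order_refl that] .
  define L where "L x = (\<Sum>b\<in>B. \<T> (x * b) *\<^sub>F b)" for x
  have "L ` V = V"
  proof (rule linear_op_inj_imp_surj_on[OF _ V])
    show "linear_op L"
      by (simp add: linear_op_iff L_def distrib_right full_trace_linear scale_left_distrib
          sum.distrib scale_sum_right)
    show "L x \<in> V" for x
      unfolding L_def using B(4) by (intro subspace_sum[OF V] subspace_scale[OF V]) auto
    show "x = 0" if x: "x \<in> V" "L x = 0" for x
    proof (rule nondegenerateD[OF nondeg x(1)])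
      have "\<T> (x * b) = 0" if "b \<in> B" for b
        using coeff_0[of "\<lambda>b. \<T> (x * b)", OF _ that] x(2) by (simp add: L_def)
      then show "\<T> (x * s) = 0" if "s \<in> V" for s
        using form.linear_eq_0_on_span[OF linear_form_trace_mult(1), of B x s] that B(3) by blast
    qed
  qed
  then have "\<forall>b\<in>B. \<exists>a\<in>V. L a = b" using B(4) by (metis imageE subsetD)
  then obtain a where a: "\<And>b. b \<in> B \<Longrightarrow> a b \<in> V" "\<And>b. b \<in> B \<Longrightarrow> L (a b) = b" by metis
  have "\<T> (a b * c) = (if b = c then 1 else 0)" if bc: "b \<in> B" "c \<in> B" for b c
  proof -
    have "(\<Sum>c\<in>B. (\<T> (a b * c) - (if b = c then 1 else 0)) *\<^sub>F c) = L (a b) - b"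
      using B(1) bc(1) by (simp add: L_def scale_left_diff_distrib sum_subtractf
          if_distrib[of "\<lambda>c. c *\<^sub>F _"] cong: if_cong)
    then show ?thesis using coeff_0[OF _ bc(2)] a(2)[OF bc(1)] by force
  qed
  then have "frame (span ((\<lambda>b. b) ` B)) B (\<lambda>b. b) (\<lambda>b x. \<T> (a b * x))"
    by (intro frame_of_dual_forms B(1) linear_form_trace_mult)
  then have "dual_bases V B a (\<lambda>b. b)" using a(1) B(3) by (simp add: dual_bases_def)
  then show ?thesis by (rule that)
qed

lemma dual_bases_commute:
  assumes V: "subspace V" "nondegenerate_on V" and dual: "dual_bases V I a b"
  shows "dual_bases V I b a"
proof -
  have fr: "frame V I b (\<lambda>i x. \<T> (a i * x))" and a: "\<And>i. i \<in> I \<Longrightarrow> a i \<in> V"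
    using dual by (auto simp: dual_bases_def)
  have "(\<Sum>i\<in>I. \<T> (b i * x) *\<^sub>F a i) = x" if x: "x \<in> V" for x
  proof (rule nondegenerate_eqI[OF V(2,1) _ x])
    show "(\<Sum>i\<in>I. \<T> (b i * x) *\<^sub>F a i) \<in> V"
      using a by (intro subspace_sum[OF V(1)] subspace_scale[OF V(1)])
    fix s assume s: "s \<in> V"
    have "\<T> ((\<Sum>i\<in>I. \<T> (b i * x) *\<^sub>F a i) * s) = (\<Sum>i\<in>I. \<T> (a i * s) * \<T> (b i * x))"
      by (simp add: sum_distrib_right full_trace_linear mult.commute)
    also have "\<dots> = \<T> (s * x)"
      by (rule frame_expand_form[OF fr linear_form_trace_mult(2) s])
    finally show "\<T> ((\<Sum>i\<in>I. \<T> (b i * x) *\<^sub>F a i) * s) = \<T> (x * s)"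
      by (simp only: full_trace_commute[of s])
  qed
  then show ?thesis
    using frame_in[OF fr] frame_finite[OF fr] a linear_form_trace_mult(1)
    by (simp add: dual_bases_def frame_def)
qed

definition casimir :: "'i set \<Rightarrow> ('i \<Rightarrow> 'v) \<Rightarrow> ('i \<Rightarrow> 'v) \<Rightarrow> 'v \<Rightarrow> 'v" where
  "casimir I a b s = (\<Sum>i\<in>I. a i * s * b i)"

lemma linear_op_casimir: "linear_op (casimir I a b)"
  unfolding casimir_def by (simp add: op.linear_compose_sum)

lemma casimir_commute:
  assumes V: "subspace V" "nondegenerate_on V" and dual: "dual_bases V I a b"
    and x: "x \<in> V" and closed: "\<And>y z. y \<in> V \<Longrightarrow> z \<in> V \<Longrightarrow> y * z \<in> V"
  shows "x * casimir I a b s = casimir I a b s * x"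
proof -
  have fr: "frame V I b (\<lambda>i x. \<T> (a i * x))" "frame V I a (\<lambda>i x. \<T> (b i * x))"
    using dual dual_bases_commute[OF V dual] by (simp_all add: dual_bases_def)
  have "x * casimir I a b s = (\<Sum>i\<in>I. (x * a i) * (s * b i))"
    by (simp add: casimir_def sum_distrib_left mult.assoc)
  also have "\<dots> = (\<Sum>i\<in>I. (\<Sum>k\<in>I. \<T> (b k * (x * a i)) *\<^sub>F a k) * (s * b i))"
    using frame_expand[OF fr(2) closed[OF x frame_in[OF fr(2)]]] by simp
  also have "\<dots> = (\<Sum>k\<in>I. \<Sum>i\<in>I. a k * s * (\<T> (b k * (x * a i)) *\<^sub>F b i))"
    by (subst sum.swap) (simp add: sum_distrib_right mult.assoc)
  also have "\<dots> = (\<Sum>k\<in>I. a k * s * (\<Sum>i\<in>I. \<T> (a i * (b k * x)) *\<^sub>F b i))"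
    by (simp add: sum_distrib_left full_trace_commute[of "a _"] mult.assoc)
  also have "\<dots> = (\<Sum>k\<in>I. a k * s * (b k * x))"
    using frame_expand[OF fr(1) closed[OF frame_in[OF fr(1)] x]] by simp
  also have "\<dots> = casimir I a b s * x"
    by (simp add: casimir_def sum_distrib_right mult.assoc)
  finally show ?thesis .
qed

lemma trace_lmult_rmult:
  assumes "dual_bases UNIV I a b"
  shows "trace_on UNIV (\<lambda>r. x * r * y) = \<T> (casimir I a b x * y)"
proof -
  have "trace_on UNIV (\<lambda>r. x * r * y) = (\<Sum>i\<in>I. \<T> (a i * (x * b i * y)))"
    using assms by (intro trace_on_frame) (simp_all add: dual_bases_def)
  then show ?thesis
    by (simp add: casimir_def sum_distrib_right full_trace_linear mult.assoc)
qed

subsection \<open>Simple extensions inside a domain subalgebra\<close>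

text \<open>Evaluation in a subalgebra whose unit \<open>e\<close> need not be \<open>1\<close>.\<close>
definition peval :: "'v \<Rightarrow> 'v \<Rightarrow> 'f poly \<Rightarrow> 'v" where
  "peval e w p = fold_coeffs (\<lambda>a s. a *\<^sub>F e + w * s) p 0"

lemma peval_0 [simp]: "peval e w 0 = 0"
  by (simp add: peval_def)

lemma peval_pCons: "peval e w (pCons a p) = a *\<^sub>F e + w * peval e w p"
  by (cases "a = 0 \<and> p = 0") (auto simp: peval_def)

lemma peval_const: "peval e w [:a:] = a *\<^sub>F e"
  by (simp add: peval_pCons)

lemma peval_add: "peval e w (p + q) = peval e w p + peval e w q"
  by (induction p q rule: poly_induct2) (auto simp: peval_pCons algebra_simps)

lemma peval_smult: "peval e w (Polynomial.smult c p) = c *\<^sub>F peval e w p"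
  by (induction p) (auto simp: peval_pCons algebra_simps)

lemma peval_sum: "peval e w (\<Sum>i\<in>I. p i) = (\<Sum>i\<in>I. peval e w (p i))"
  by (induction I rule: infinite_finite_induct) (auto simp: peval_add)

definition adjoin :: "'v \<Rightarrow> 'v \<Rightarrow> 'v set" where
  "adjoin e w = range (peval e w)"

definition minimal_poly :: "'v \<Rightarrow> 'v \<Rightarrow> 'f poly \<Rightarrow> bool" where
  "minimal_poly e w g \<longleftrightarrow> g \<noteq> 0 \<and> (\<forall>p. peval e w p = 0 \<longleftrightarrow> g dvd p)"

lemma minimal_polyD:
  assumes "minimal_poly e w g"
  shows minimal_poly_nonzero: "g \<noteq> 0"
    and peval_eq_0_iff: "peval e w p = 0 \<longleftrightarrow> g dvd p"
  using assms by (simp_all add: minimal_poly_def)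

context
  fixes E e w
  assumes E: "domain_subalgebra E e" and w: "w \<in> E"
begin

lemma peval_in: "peval e w p \<in> E"
proof (induction p)
  case (pCons a p)
  then show ?case
    unfolding peval_pCons using domain_subspace[OF E] domain_unit(1)[OF E] domain_mult[OF E w]
    by (intro subspace_add subspace_scale)
qed (simp add: subspace_0[OF domain_subspace[OF E]])

lemma peval_1: "peval e w 1 = e"
  by (simp add: one_pCons peval_const)

lemma peval_X: "peval e w [:0, 1:] = w"
  by (simp add: peval_pCons domain_unit_right[OF E w])

lemma peval_mult: "peval e w (p * q) = peval e w p * peval e w q"
proof (induction p)
  case (pCons a p)
  then show ?case
    using domain_unit_left[OF E peval_in]
    by (simp add: peval_add peval_smult peval_pCons distrib_right mult.assoc)
qed simp

lemma unit_mult_power_Suc: "e * w ^ Suc i = w * (e * w ^ i)"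
  using domain_unit_left[OF E w] domain_unit_right[OF E w] by (simp flip: mult.assoc)

lemma inverse_power_mult_power:
  assumes x: "x \<in> E" "x * w = e" and "i \<le> k"
  shows "x ^ k * (e * w ^ i) = e * x ^ (k - i)"
  using \<open>i \<le> k\<close>
proof (induction i arbitrary: k)
  case 0
  have "e * x = x * e" using domain_unit_left[OF E x(1)] domain_unit_right[OF E x(1)] by simp
  then show ?case by (simp add: power_commuting_commutes[symmetric])
next
  case (Suc i)
  then obtain l where k: "k = Suc l" by (cases k) auto
  have "x ^ k * (e * w ^ Suc i) = x ^ l * (x * w * (e * w ^ i))"
    unfolding unit_mult_power_Suc k power_Suc2[of x] by (simp only: mult.assoc)
  also have "\<dots> = x ^ l * (e * w ^ i)"
    using domain_unit_left[OF E domain_unit(1)[OF E]] by (simp add: x(2) flip: mult.assoc)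
  finally show ?case using Suc k by simp
qed

lemma peval_monom: "peval e w (monom c i) = c *\<^sub>F (e * w ^ i)"
  by (induction i)
    (simp_all add: monom_0 monom_Suc peval_const peval_pCons unit_mult_power_Suc del: power_Suc)

lemma peval_expand:
  assumes "degree p \<le> n"
  shows "peval e w p = (\<Sum>i\<le>n. coeff p i *\<^sub>F (e * w ^ i))"
proof -
  have "p = (\<Sum>i\<le>n. monom (coeff p i) i)"
    using assms by (simp add: poly_as_sum_of_monoms')
  then have "peval e w p = peval e w (\<Sum>i\<le>n. monom (coeff p i) i)" by (rule arg_cong)
  then show ?thesis by (simp only: peval_sum peval_monom)
qed

lemma annihilating_poly_exists: "\<exists>p. p \<noteq> 0 \<and> peval e w p = 0"
proof -
  have "\<not> independent_family {..dim UNIV} (\<lambda>i. e * w ^ i)"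
    using independent_family_card_le_dim[of "{..dim UNIV}"] by auto
  then obtain c k where c: "(\<Sum>i\<le>dim UNIV. c i *\<^sub>F (e * w ^ i)) = 0" and k: "k \<le> dim UNIV" "c k \<noteq> 0"
    by (auto simp: independent_family_def)
  let ?p = "\<Sum>i\<le>dim UNIV. monom (c i) i"
  have "coeff ?p k \<noteq> 0" using k by (simp add: coeff_sum)
  moreover have "peval e w ?p = 0" using c by (simp only: peval_sum peval_monom)
  ultimately show ?thesis by (intro exI[of _ ?p]) auto
qed

lemma minimal_poly_exists: "\<exists>g. minimal_poly e w g"
proof -
  obtain g where g: "g \<noteq> 0" "peval e w g = 0"
    and least: "\<And>p. p \<noteq> 0 \<Longrightarrow> peval e w p = 0 \<Longrightarrow> degree g \<le> degree p"
    using annihilating_poly_exists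
      ex_has_least_nat[of "\<lambda>p. p \<noteq> 0 \<and> peval e w p = 0" _ degree] by blast
  have "g dvd p" if "peval e w p = 0" for p
  proof -
    have "peval e w p = peval e w (g * (p div g) + p mod g)" by simp
    also have "\<dots> = peval e w (p mod g)" by (simp only: peval_add peval_mult) (simp add: g(2))
    finally have "peval e w (p mod g) = 0" using that by simp
    then have "p mod g = 0" using least[of "p mod g"] degree_mod_less[OF g(1), of p] by force
    then show ?thesis by (simp add: dvd_eq_mod_eq_0)
  qed
  then have "minimal_poly e w g" using g by (auto simp: minimal_poly_def peval_mult elim: dvdE)
  then show ?thesis by blast
qed

lemma adjoin_domain: "domain_subalgebra (adjoin e w) e"
  unfolding domain_subalgebra_def
proof (intro conjI ballI impI)
  show "subspace (adjoin e w)"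
    unfolding adjoin_def
    by (rule subspaceI) (auto simp flip: peval_add peval_smult intro: range_eqI[of _ _ 0])
  show "e \<in> adjoin e w" unfolding adjoin_def using peval_1 by (metis rangeI)
  show "e \<noteq> 0" by (rule domain_unit(2)[OF E])
  fix x y assume xy: "x \<in> adjoin e w" "y \<in> adjoin e w"
  then show "x * y \<in> adjoin e w" unfolding adjoin_def by (auto simp flip: peval_mult)
  have "x \<in> E" "y \<in> E" using xy peval_in by (auto simp: adjoin_def)
  then show "e * x = x" "x * e = x"
    using domain_unit_left[OF E] domain_unit_right[OF E] by blast+
  show "x = 0 \<or> y = 0" if "x * y = 0"
    using domain_mult_eq_0[OF E \<open>x \<in> E\<close> \<open>y \<in> E\<close> that] .
qed

lemma adjoin_commute: "x \<in> adjoin e w \<Longrightarrow> y \<in> adjoin e w \<Longrightarrow> x * y = y * x"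
  unfolding adjoin_def by (auto simp: mult.commute simp flip: peval_mult)

lemma generator_in_adjoin: "w \<in> adjoin e w"
  unfolding adjoin_def using peval_X by (metis rangeI)

lemma adjoin_subset: "adjoin e w \<subseteq> E"
  unfolding adjoin_def using peval_in by auto

context
  fixes g
  assumes g: "minimal_poly e w g"
begin

lemma prime_minimal_poly: "prime_elem g"
proof (rule prime_elemI)
  show "g \<noteq> 0" by (rule minimal_poly_nonzero[OF g])
  show "\<not> is_unit g"
    using domain_unit(2)[OF E] peval_1 peval_eq_0_iff[OF g, of 1] by simp
  fix p q assume "g dvd p * q"
  then have "peval e w p * peval e w q = 0" by (simp flip: peval_eq_0_iff[OF g] add: peval_mult)
  then show "g dvd p \<or> g dvd q"
    using domain_mult_eq_0[OF E peval_in peval_in] by (simp flip: peval_eq_0_iff[OF g])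
qed

lemma degree_minimal_poly: "degree g > 0"
  using prime_minimal_poly is_unit_iff_degree[of g] by (auto simp: prime_elem_def)

lemma coeff_0_minimal_poly:
  assumes "w \<noteq> 0"
  shows "coeff g 0 \<noteq> 0"
proof
  assume "coeff g 0 = 0"
  then obtain h where h: "g = pCons 0 h" by (metis coeff_pCons_0 pCons_cases)
  have "w * peval e w h = 0"
    using peval_eq_0_iff[OF g, of g] by (simp add: h peval_pCons)
  then have "g dvd h"
    using domain_mult_eq_0[OF E w peval_in] assms by (auto simp flip: peval_eq_0_iff[OF g])
  moreover have "h \<noteq> 0" using minimal_poly_nonzero[OF g] h by auto
  ultimately show False using dvd_imp_degree_le[of g h] h by simp
qed

lemma peval_degree_less_eq_0:
  assumes "degree p < degree g" "peval e w p = 0"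
  shows "p = 0"
  using assms dvd_imp_degree_le[of g p] by (auto simp: peval_eq_0_iff[OF g])

lemma peval_degree_less:
  assumes "degree p < degree g"
  shows "peval e w p = (\<Sum>i<degree g. coeff p i *\<^sub>F (e * w ^ i))"
  using peval_expand[of p "degree g - 1"] assms lessThan_Suc_atMost[of "degree g - 1"] by simp

lemma independent_powers: "independent_family {..<degree g} (\<lambda>i. e * w ^ i)"
  unfolding independent_family_def
proof (intro allI impI ballI)
  fix c k assume c: "(\<Sum>i<degree g. c i *\<^sub>F (e * w ^ i)) = 0" and k: "k \<in> {..<degree g}"
  let ?p = "\<Sum>i<degree g. monom (c i) i"
  have "degree ?p < degree g"
    using k by (intro degree_lessI) (auto simp: coeff_sum)
  moreover have "peval e w ?p = 0" using c by (simp only: peval_sum peval_monom)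
  ultimately have "?p = 0" by (rule peval_degree_less_eq_0)
  then have "coeff ?p k = coeff 0 k" by (rule arg_cong)
  then show "c k = 0" using k by (simp add: coeff_sum)
qed

lemma span_powers: "span ((\<lambda>i. e * w ^ i) ` {..<degree g}) = adjoin e w"
proof
  have "e * w ^ i \<in> adjoin e w" for i
    unfolding adjoin_def using peval_monom[of 1 i] by (metis rangeI scale_one)
  then show "span ((\<lambda>i. e * w ^ i) ` {..<degree g}) \<subseteq> adjoin e w"
    by (intro span_minimal domain_subspace[OF adjoin_domain]) auto
  show "adjoin e w \<subseteq> span ((\<lambda>i. e * w ^ i) ` {..<degree g})"
  proof
    fix x assume "x \<in> adjoin e w"
    then obtain p where p: "x = peval e w p" by (auto simp: adjoin_def)
    have "peval e w (p - p mod g) = 0"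
      by (simp add: peval_eq_0_iff[OF g] minus_mod_eq_mult_div)
    then have "x = peval e w (p mod g)"
      unfolding p using peval_add[of e w "p - p mod g" "p mod g"] by simp
    also have "\<dots> = (\<Sum>i<degree g. coeff (p mod g) i *\<^sub>F (e * w ^ i))"
      using degree_mod_less[OF minimal_poly_nonzero[OF g], of p] degree_minimal_poly
      by (intro peval_degree_less) auto
    also have "\<dots> \<in> span ((\<lambda>i. e * w ^ i) ` {..<degree g})"
      by (intro span_sum span_scale span_base imageI)
    finally show "x \<in> span ((\<lambda>i. e * w ^ i) ` {..<degree g})" .
  qed
qed

lemma dim_adjoin: "dim (adjoin e w) = degree g"
  using dim_span_independent_family[OF _ independent_powers] by (simp add: span_powers)

lemma inverse_eq_peval:
  assumes x: "x \<in> E" "x * w = e" and g0: "coeff g 0 \<noteq> 0"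
  shows "x = peval e w (Polynomial.smult (- inverse (coeff g 0)) (poly_shift 1 g))"
proof -
  obtain a h where h: "g = pCons a h" by (cases g)
  have "a *\<^sub>F e + w * peval e w h = 0"
    using peval_eq_0_iff[OF g, of g] by (simp add: h peval_pCons)
  then have "w * peval e w h = (- a) *\<^sub>F e" by (simp add: eq_neg_iff_add_eq_0 add.commute)
  then have "x * (w * peval e w h) = x * ((- a) *\<^sub>F e)" by (rule arg_cong)
  then have "peval e w h = (- a) *\<^sub>F x"
    using domain_unit_left[OF E peval_in] domain_unit_right[OF E x(1)] x(2)
    by (simp flip: mult.assoc)
  moreover have "poly_shift 1 g = h" by (rule poly_eqI) (simp add: h coeff_poly_shift)
  ultimately show ?thesis unfolding peval_smult using g0 by (simp add: h)
qed

text \<open>Multiplication by \<open>x\<close> shifts the basis \<open>e, w, \<dots>, w^(q - 1)\<close>, so only \<open>x e\<close> contributes.\<close>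
lemma regular_trace_inverse:
  assumes x: "x \<in> E" "x * w = e" and g0: "coeff g 0 \<noteq> 0"
  shows "regular_trace (adjoin e w) x * coeff g 0 = - coeff g 1"
proof -
  define p where "p = Polynomial.smult (- inverse (coeff g 0)) (poly_shift 1 g)"
  have xp: "x = peval e w p" unfolding p_def by (rule inverse_eq_peval[OF x g0])
  obtain f where f: "\<And>i. i \<in> {..<degree g} \<Longrightarrow> linear_form (f i)"
    "\<And>i k. i \<in> {..<degree g} \<Longrightarrow> k \<in> {..<degree g} \<Longrightarrow> f i (e * w ^ k) = (if i = k then 1 else 0)"
    using dual_forms_exist[OF _ independent_powers] by auto
  have fr: "frame (adjoin e w) {..<degree g} (\<lambda>i. e * w ^ i) f"
    using frame_of_dual_forms[of "{..<degree g}" f "\<lambda>i. e * w ^ i"] f by (simp add: span_powers)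
  obtain d where d: "degree g = Suc d" using degree_minimal_poly by (cases "degree g") auto
  have shift: "x * (e * w ^ Suc i) = e * w ^ i" for i
  proof -
    have "e * (e * w ^ i) = e * w ^ i"
      using domain_unit_left[OF E domain_unit(1)[OF E]] by (simp flip: mult.assoc)
    then show ?thesis unfolding unit_mult_power_Suc using x(2) by (simp flip: mult.assoc)
  qed
  have "degree p < degree g"
    unfolding p_def by (intro degree_lessI) (auto simp: coeff_poly_shift coeff_eq_0 d)
  then have "x = (\<Sum>i<degree g. coeff p i *\<^sub>F (e * w ^ i))"
    unfolding xp by (rule peval_degree_less)
  then have "f 0 x = f 0 (\<Sum>i<degree g. coeff p i *\<^sub>F (e * w ^ i))" by (rule arg_cong)
  also have "\<dots> = (\<Sum>i<degree g. coeff p i * f 0 (e * w ^ i))"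
    by (rule linear_form_lincomb[OF f(1)]) (simp add: d)
  also have "\<dots> = (\<Sum>i<degree g. if i = 0 then coeff p 0 else 0)"
    by (intro sum.cong) (auto simp: f(2) d)
  also have "\<dots> = coeff p 0" by (simp add: d)
  finally have f0: "f 0 x = coeff p 0" .
  have "x \<in> adjoin e w" using xp by (simp add: adjoin_def)
  then have "regular_trace (adjoin e w) x = (\<Sum>i<degree g. f i (x * (e * w ^ i)))"
    unfolding regular_trace_def using domain_mult[OF adjoin_domain]
    by (intro trace_on_frame[OF domain_subspace[OF adjoin_domain] fr]) simp_all
  also have "\<dots> = f 0 x + (\<Sum>i<d. f (Suc i) (e * w ^ i))"
    unfolding d sum.lessThan_Suc_shift shift by (simp add: domain_unit_right[OF E x(1)])
  also have "\<dots> = coeff p 0" by (simp add: f0 f(2) d)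
  finally show ?thesis using g0 by (simp add: p_def coeff_poly_shift)
qed

end

end

definition (in central_algebra) cayley_hamilton_at :: "('v \<Rightarrow> 'f) \<Rightarrow> nat \<Rightarrow> 'v \<Rightarrow> bool" where
  "cayley_hamilton_at t m x \<longleftrightarrow>
     x ^ m + (\<Sum>i\<in>{1..m}. ((-1)^i * newton_e (\<lambda>k. t (x ^ k)) i) *\<^sub>F x ^ (m - i)) = 0"

lemma newton_e_eq_0_if_cayley_hamilton:
  assumes t: "linear_form t" and ch: "cayley_hamilton_at t m x" and "i > m"
  shows "newton_e (\<lambda>k. t (x ^ k)) i = 0"
proof (rule newton_e_eq_0[OF _ \<open>i > m\<close>])
  fix k assume k: "k > m"
  let ?c = "\<lambda>l. (-1)^l * newton_e (\<lambda>k. t (x ^ k)) l"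
  have "(\<Sum>l\<le>m. ?c l *\<^sub>F x ^ (k - l)) = (\<Sum>l\<le>m. x ^ (k - m) * ?c l *\<^sub>F x ^ (m - l))"
    using k by (intro sum.cong) (auto simp flip: power_add)
  also have "\<dots> = x ^ (k - m) * (\<Sum>l\<le>m. ?c l *\<^sub>F x ^ (m - l))" by (rule sum_distrib_left[symmetric])
  also have "(\<Sum>l\<le>m. ?c l *\<^sub>F x ^ (m - l)) = 0"
    using ch by (simp add: cayley_hamilton_at_def atMost_atLeast0 sum.atLeast_Suc_atMost)
  finally have "t (\<Sum>l\<le>m. ?c l *\<^sub>F x ^ (k - l)) = 0" by (simp add: form.linear_0[OF t])
  then show "(\<Sum>l\<le>m. ?c l * t (x ^ (k - l))) = 0" by (simp only: linear_form_lincomb[OF t])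
qed

text \<open>The values \<open>t (e x\<^sup>k)\<close> satisfy the recurrence given by the minimal polynomial of \<open>w\<close>; the
  factor \<open>e\<close> only matters for \<open>k = 0\<close>, on which Newton's identities do not depend.\<close>
lemma cayley_hamilton_trace_adjoin:
  assumes E: "domain_subalgebra E e" and x: "x \<in> E" and w: "w \<in> E" and inv: "x * w = e" "w * x = e"
    and t: "linear_form t" and ch: "cayley_hamilton_at t m x"
  shows "\<exists>b. t e = of_nat b * regular_trace (adjoin e w) e \<and>
    t x = of_nat b * regular_trace (adjoin e w) x"
proof -
  obtain g where g: "minimal_poly e w g" using minimal_poly_exists[OF E w] by blast
  have "w \<noteq> 0" using inv(1) domain_unit(2)[OF E] by auto
  then have g0: "coeff g 0 \<noteq> 0" by (rule coeff_0_minimal_poly[OF E w g])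
  define s where "s k = t (e * x ^ k)" for k
  have ex: "e * x ^ k = x ^ k" if "k > 0" for k
    using that domain_unit_left[OF E x] by (cases k) (simp_all flip: mult.assoc)
  have "newton_e s i = newton_e (\<lambda>k. t (x ^ k)) i" for i
    by (rule newton_e_cong) (simp add: s_def ex)
  then have vanish: "newton_e s i = 0" if "i > m" for i
    using newton_e_eq_0_if_cayley_hamilton[OF t ch that] by simp
  have "(\<Sum>i\<le>degree g. coeff g i * s (k - i)) = 0" if k: "k \<ge> degree g" for k
  proof -
    have "0 = x ^ k * peval e w g" using peval_eq_0_iff[OF g, of g] by simp
    also have "\<dots> = (\<Sum>i\<le>degree g. coeff g i *\<^sub>F (e * x ^ (k - i)))"
      using k inverse_power_mult_power[OF E w x inv(1)]
      by (simp add: peval_expand[OF E w order_refl] sum_distrib_left)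
    finally have "t (\<Sum>i\<le>degree g. coeff g i *\<^sub>F (e * x ^ (k - i))) = 0"
      using form.linear_0[OF t] by simp
    then show ?thesis by (simp only: linear_form_lincomb[OF t] s_def)
  qed
  then obtain b where b: "s 0 = of_nat (b * degree g)" "s 1 * coeff g 0 = - of_nat b * coeff g 1"
    using power_sums_of_prime_recurrence[OF prime_minimal_poly[OF E w g] vanish] by blast
  have "t e = of_nat b * regular_trace (adjoin e w) e"
    using b(1) regular_trace_unit[OF adjoin_domain[OF E w]] by (simp add: s_def dim_adjoin[OF E w g])
  moreover have "t x * coeff g 0 = of_nat b * regular_trace (adjoin e w) x * coeff g 0"
    using b(2) regular_trace_inverse[OF E w g x inv(1) g0]
      by (simp add: s_def ex[of 1, simplified] mult.assoc)
  ultimately show ?thesis using g0 by auto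
qed

end

subsection \<open>Elements of maximal degree\<close>

lemma poly_det:
  fixes M :: "'a::comm_ring_1 poly mat"
  shows "poly (det M) c = det (map_mat (\<lambda>p. poly p c) M)"
proof -
  interpret comm_ring_hom "\<lambda>p :: 'a poly. poly p c" by unfold_locales auto
  show ?thesis by (rule hom_det[symmetric])
qed

lemma nonsingular_specialization_exists:
  fixes M :: "'a::field_char_0 poly mat"
  assumes "det (map_mat (\<lambda>p. poly p a) M) \<noteq> 0"
  shows "\<exists>c. c \<noteq> a \<and> det (map_mat (\<lambda>p. poly p c) M) \<noteq> 0"
proof -
  have "det M \<noteq> 0" using assms by (auto simp flip: poly_det)
  then have "finite (insert a {c. poly (det M) c = 0})" by (simp add: poly_roots_finite)
  then obtain c where "c \<notin> insert a {c. poly (det M) c = 0}"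
    using ex_new_if_finite[OF infinite_UNIV_char_0] by metis
  then show ?thesis by (intro exI[of _ c]) (simp add: poly_det)
qed

context central_algebra
begin

definition poly_curve :: "('f \<Rightarrow> 'v) \<Rightarrow> bool" where
  "poly_curve u \<longleftrightarrow> (\<forall>\<psi>. linear_form \<psi> \<longrightarrow> (\<exists>p. \<forall>c. \<psi> (u c) = poly p c))"

lemma poly_curve_const: "poly_curve (\<lambda>c. a)"
  unfolding poly_curve_def by (auto intro: exI[of _ "[:\<psi> a:]" for \<psi>])

lemma poly_curve_add:
  assumes "poly_curve u" "poly_curve v"
  shows "poly_curve (\<lambda>c. u c + v c)"
  unfolding poly_curve_def
proof (intro allI impI)
  fix \<psi> assume \<psi>: "linear_form \<psi>"
  obtain p q where "\<And>c. \<psi> (u c) = poly p c" "\<And>c. \<psi> (v c) = poly q c"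
    using assms \<psi> unfolding poly_curve_def by metis
  then show "\<exists>p. \<forall>c. \<psi> (u c + v c) = poly p c"
    by (intro exI[of _ "p + q"]) (simp add: form.linear_add[OF \<psi>])
qed

lemma poly_curve_lmult:
  assumes "poly_curve u"
  shows "poly_curve (\<lambda>c. a * u c)"
  using assms linear_form_compose[OF _ linear_op_mult(1)] unfolding poly_curve_def by blast

lemma poly_curve_scale:
  assumes "poly_curve u"
  shows "poly_curve (\<lambda>c. c *\<^sub>F u c)"
  unfolding poly_curve_def
proof (intro allI impI)
  fix \<psi> assume \<psi>: "linear_form \<psi>"
  obtain p where "\<And>c. \<psi> (u c) = poly p c" using assms \<psi> unfolding poly_curve_def by metis
  then show "\<exists>p. \<forall>c. \<psi> (c *\<^sub>F u c) = poly p c"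
    by (intro exI[of _ "[:0, 1:] * p"]) (simp add: form.linear_scale[OF \<psi>])
qed

lemma independent_family_if_det:
  fixes n :: nat
  assumes \<psi>: "\<And>i. i < n \<Longrightarrow> linear_form (\<psi> i)"
    and det: "det (mat n n (\<lambda>(i, k). \<psi> i (v k))) \<noteq> 0"
  shows "independent_family {..<n} v"
  unfolding independent_family_def
proof (intro allI impI ballI)
  fix a k assume a: "(\<Sum>k<n. a k *\<^sub>F v k) = 0" and k: "k \<in> {..<n}"
  let ?A = "mat n n (\<lambda>(i, k). \<psi> i (v k))"
  have "?A *\<^sub>v vec n a = 0\<^sub>v n"
  proof (rule eq_vecI)
    fix i assume "i < dim_vec (0\<^sub>v n :: 'f vec)"
    then have i: "i < n" by simp
    have "(?A *\<^sub>v vec n a) $ i = (\<Sum>k<n. a k * \<psi> i (v k))"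
      using i by (simp add: scalar_prod_def lessThan_atLeast0 mult.commute)
    also have "\<dots> = \<psi> i (\<Sum>k<n. a k *\<^sub>F v k)" by (rule linear_form_lincomb[OF \<psi>[OF i], symmetric])
    finally show "(?A *\<^sub>v vec n a) $ i = 0\<^sub>v n $ i" using i by (simp add: a form.linear_0[OF \<psi>])
  qed simp
  moreover have "?A \<in> carrier_mat n n" "vec n a \<in> carrier_vec n" by simp_all
  ultimately have "vec n a = 0\<^sub>v n" using det det_0_iff_vec_prod_zero_field by blast
  then show "a k = 0" using k by (metis index_vec index_zero_vec(1) lessThan_iff)
qed

text \<open>Linear independence is Zariski open: some minor is a nonzero polynomial in the parameter.\<close>
lemma independent_poly_curves:
  fixes n :: nat
  assumes u: "\<And>k. k < n \<Longrightarrow> poly_curve (u k)" and indep: "independent_family {..<n} (\<lambda>k. u k a)"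
  shows "\<exists>c. c \<noteq> a \<and> independent_family {..<n} (\<lambda>k. u k c)"
proof -
  obtain \<psi> where \<psi>: "\<And>i. i \<in> {..<n} \<Longrightarrow> linear_form (\<psi> i)"
    "\<And>i k. i \<in> {..<n} \<Longrightarrow> k \<in> {..<n} \<Longrightarrow> \<psi> i (u k a) = (if i = k then 1 else 0)"
    using dual_forms_exist[OF _ indep] by auto
  have "\<forall>i k. \<exists>p. i < n \<and> k < n \<longrightarrow> (\<forall>c. \<psi> i (u k c) = poly p c)"
    using u \<psi>(1) unfolding poly_curve_def by blast
  then obtain p where p: "\<And>i k c. i < n \<Longrightarrow> k < n \<Longrightarrow> \<psi> i (u k c) = poly (p i k) c" by metis
  define M where "M = mat n n (\<lambda>(i, k). p i k)"
  have M: "map_mat (\<lambda>p. poly p c) M = mat n n (\<lambda>(i, k). \<psi> i (u k c))" for c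
    by (rule eq_matI) (auto simp: M_def p)
  have "mat n n (\<lambda>(i, k). \<psi> i (u k a)) = 1\<^sub>m n"
    by (rule eq_matI) (auto simp: \<psi>(2))
  then obtain c where "c \<noteq> a" "det (mat n n (\<lambda>(i, k). \<psi> i (u k c))) \<noteq> 0"
    using nonsingular_specialization_exists[of a M] by (auto simp: M)
  then show ?thesis using independent_family_if_det[of n \<psi>] \<psi>(1) by auto
qed

lemma independent_family_Suc:
  fixes v :: "nat \<Rightarrow> 'v"
  assumes "independent_family {..<n} v" "v n \<notin> span (v ` {..<n})"
  shows "independent_family {..<Suc n} v"
proof -
  have v: "inj_on v {..<n}" "independent (v ` {..<n})"
    using assms(1) by (simp_all add: independent_family_iff)
  have "v n \<notin> v ` {..<n}" using assms(2) span_superset by (rule contra_subsetD[rotated])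
  then show ?thesis
    using v independent_insertI[OF assms(2) v(2)] by (simp add: independent_family_iff lessThan_Suc)
qed

end

context fd_central_algebra
begin

lemma peval_commute:
  assumes "e * b = b" "b * e = b" "b * y = y * b"
  shows "b * peval e y p = peval e y p * b"
proof (induction p)
  case (pCons a p)
  have "b * (y * peval e y p) = y * (b * peval e y p)" by (simp add: assms(3) flip: mult.assoc)
  then show ?case by (simp add: peval_pCons pCons(2) assms distrib_left distrib_right mult.assoc)
qed simp

lemma poly_curve_powers:
  assumes D: "domain_subalgebra D e" and y: "y \<in> D" and b: "b \<in> D"
  shows "poly_curve (\<lambda>c. e * (y + c *\<^sub>F b) ^ k)"
proof (induction k)
  case (Suc k)
  have in_D: "y + c *\<^sub>F b \<in> D" for c
    using y b domain_subspace[OF D] by (intro subspace_add subspace_scale)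
  have "e * (y + c *\<^sub>F b) ^ Suc k =
      y * (e * (y + c *\<^sub>F b) ^ k) + c *\<^sub>F (b * (e * (y + c *\<^sub>F b) ^ k))" for c
    unfolding unit_mult_power_Suc[OF D in_D] by (simp add: distrib_right)
  then show ?case
    using poly_curve_add[OF poly_curve_lmult[OF Suc] poly_curve_scale[OF
            poly_curve_lmult[OF Suc]], of y b]
    by simp
qed (simp add: poly_curve_const)

lemma peval_taylor:
  assumes b: "e * b = b" "b * e = b" "b * y = y * b"
  obtains R where "poly_curve R" "R 0 = peval e y (pderiv p) * b"
    "\<And>c. peval e (y + c *\<^sub>F b) p = peval e y p + c *\<^sub>F R c"
proof -
  have "\<exists>R. poly_curve R \<and> R 0 = peval e y (pderiv p) * b \<and>
      (\<forall>c. peval e (y + c *\<^sub>F b) p = peval e y p + c *\<^sub>F R c)"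
  proof (induction p)
    case 0
    then show ?case by (intro exI[of _ "\<lambda>c. 0"]) (simp add: poly_curve_const)
  next
    case (pCons a p)
    then obtain R where R: "poly_curve R" "R 0 = peval e y (pderiv p) * b"
      "\<And>c. peval e (y + c *\<^sub>F b) p = peval e y p + c *\<^sub>F R c" by blast
    define R' where "R' c = b * peval e y p + (y * R c + c *\<^sub>F (b * R c))" for c
    have "poly_curve R'"
      unfolding R'_def
      by (intro poly_curve_add poly_curve_const poly_curve_scale poly_curve_lmult R(1))
    moreover have "R' 0 = peval e y (pderiv (pCons a p)) * b"
      by (simp add: R'_def R(2) pderiv_pCons peval_add peval_pCons peval_commute[OF b]
          distrib_right mult.assoc)
    moreover have "peval e (y + c *\<^sub>F b) (pCons a p) = peval e y (pCons a p) + c *\<^sub>F R' c" for c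
      by (simp add: peval_pCons R(3) R'_def algebra_simps)
    ultimately show ?case by blast
  qed
  then show ?thesis using that by blast
qed

lemma degree_minimal_poly_gt:
  assumes E: "domain_subalgebra E e" "y \<in> E" and g': "minimal_poly e y g'" and "g \<noteq> 0" "c \<noteq> 0"
    and indep: "independent_family {..<Suc (degree g)} v"
    and v: "\<And>i. i < degree g \<Longrightarrow> v i = e * y ^ i" "peval e y g = c *\<^sub>F v (degree g)"
  shows "degree g' > degree g"
proof (rule ccontr)
  assume "\<not> degree g' > degree g"
  define q where "q = degree g"
  define \<alpha> where "\<alpha> = coeff g' q / coeff g q"
  define r where "r = g' - Polynomial.smult \<alpha> g"
  have "coeff g q \<noteq> 0" using \<open>g \<noteq> 0\<close> by (simp add: q_def)
  then have r: "coeff r i = 0" if "i \<ge> q" for i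
    using that \<open>\<not> degree g' > degree g\<close>
    by (cases "i = q") (auto simp: r_def \<alpha>_def q_def coeff_eq_0)
  have "peval e y r + \<alpha> *\<^sub>F peval e y g = peval e y g'"
    by (simp add: r_def flip: peval_smult peval_add)
  also have "\<dots> = 0" using peval_eq_0_iff[OF g', of g'] by simp
  finally have "peval e y r + (\<alpha> * c) *\<^sub>F v q = 0" by (simp add: v(2) q_def)
  moreover have "degree r \<le> q" using r by (intro degree_le) simp
  then have "peval e y r = (\<Sum>i<q. coeff r i *\<^sub>F (e * y ^ i))"
    using peval_expand[OF E] r[of q] by (simp add: lessThan_Suc_atMost[symmetric])
  ultimately have "(\<Sum>i<Suc q. (if i < q then coeff r i else \<alpha> * c) *\<^sub>F v i) = 0"
    by (simp add: v(1) q_def)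
  from independent_familyD[OF indep[folded q_def] this]
  have coeffs: "(if i < q then coeff r i else \<alpha> * c) = 0" if "i < Suc q" for i
    using that by simp
  then have "r = 0" using r by (intro poly_eqI) (metis coeff_0 less_SucI not_less)
  moreover have "\<alpha> = 0" using coeffs[of q] \<open>c \<noteq> 0\<close> by simp
  ultimately show False using minimal_poly_nonzero[OF g'] by (simp add: r_def)
qed

lemma peval_pderiv_mult_notin_adjoin:
  assumes D: "domain_subalgebra D e" and y: "y \<in> D" and g: "minimal_poly e y g"
    and b: "b \<in> D" "b \<notin> adjoin e y"
  shows "peval e y (pderiv g) * b \<notin> adjoin e y"
proof
  note A = adjoin_domain[OF D y]
  let ?d = "peval e y (pderiv g)"
  assume d_b: "?d * b \<in> adjoin e y"
  have "\<not> g dvd pderiv g" using degree_minimal_poly[OF D y g] by simp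
  then have "?d \<noteq> 0" by (simp add: peval_eq_0_iff[OF g])
  then obtain i where i: "i \<in> adjoin e y" "i * ?d = e"
    using domain_inverse_exists[OF A] unfolding adjoin_def by (metis rangeI)
  have "b = i * (?d * b)" using domain_unit_left[OF D b(1)] by (simp add: i(2) flip: mult.assoc)
  then show False using b(2) domain_mult[OF A i(1) d_b] by simp
qed

lemma add_scale_notin_subspace:
  assumes V: "subspace V" and y: "y \<in> V" and b: "b \<notin> V" and "c \<noteq> 0"
  shows "y + c *\<^sub>F b \<notin> V"
proof
  assume "y + c *\<^sub>F b \<in> V"
  then have "(y + c *\<^sub>F b) - y \<in> V" using y by (rule subspace_diff[OF V])
  then have "c *\<^sub>F b \<in> V" by simp
  then have "inverse c *\<^sub>F (c *\<^sub>F b) \<in> V" by (rule subspace_scale[OF V])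
  then show False using b \<open>c \<noteq> 0\<close> by simp
qed

text \<open>If \<open>b\<close> commutes with \<open>y\<close> but lies outside \<open>F[y]\<close>, then so does \<open>g'(y) b\<close>, the derivative at
  \<open>c = 0\<close> of \<open>g(y + c b)\<close>; hence some \<open>y + c b\<close> has larger degree than \<open>y\<close>.\<close>
lemma larger_degree_exists:
  assumes D: "domain_subalgebra D e" and y: "y \<in> D" and g: "minimal_poly e y g"
    and b: "b \<in> D" "b * y = y * b" "b \<notin> adjoin e y"
  obtains y' where "y' \<in> D" "y' \<noteq> 0" "\<And>g'. minimal_poly e y' g' \<Longrightarrow> degree g < degree g'"
proof -
  define q where "q = degree g"
  note A = domain_subspace[OF adjoin_domain[OF D y]]
  have eb: "e * b = b" "b * e = b" using domain_unit_left[OF D b(1)] domain_unit_right[OF D b(1)] .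
  obtain R where R: "poly_curve R" "R 0 = peval e y (pderiv g) * b"
    "\<And>c. peval e (y + c *\<^sub>F b) g = peval e y g + c *\<^sub>F R c"
    using peval_taylor[OF eb b(2), of g] by blast
  have "R 0 \<notin> adjoin e y"
    unfolding R(2) by (rule peval_pderiv_mult_notin_adjoin[OF D y g b(1,3)])
  define u where "u k c = (if k < q then e * (y + c *\<^sub>F b) ^ k else R c)" for k c
  have "(\<lambda>k. u k 0) ` {..<q} = (\<lambda>k. e * y ^ k) ` {..<q}" by (simp add: u_def)
  then have "u q 0 \<notin> span ((\<lambda>k. u k 0) ` {..<q})"
    using \<open>R 0 \<notin> adjoin e y\<close> span_powers[OF D y g] by (simp add: u_def q_def)
  moreover have "independent_family {..<q} (\<lambda>k. u k 0)"
    using independent_powers[OF D y g] by (simp add: u_def q_def independent_family_def)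
  ultimately have "independent_family {..<Suc q} (\<lambda>k. u k 0)"
    by (rule independent_family_Suc[rotated])
  moreover have "poly_curve (u k)" for k
    unfolding u_def using poly_curve_powers[OF D y b(1)] R(1) by (cases "k < q") simp_all
  ultimately obtain c where c: "c \<noteq> 0" "independent_family {..<Suc q} (\<lambda>k. u k c)"
    using independent_poly_curves by metis
  let ?y = "y + c *\<^sub>F b"
  have "?y \<in> D" using y b(1) domain_subspace[OF D] by (intro subspace_add subspace_scale)
  moreover have "?y \<notin> adjoin e y"
    by (rule add_scale_notin_subspace[OF A generator_in_adjoin[OF D y] b(3) c(1)])
  then have "?y \<noteq> 0" using subspace_0[OF A] by auto
  moreover have "degree g < degree g'" if "minimal_poly e ?y g'" for g'
  proof (rule degree_minimal_poly_gt[OF D \<open>?y \<in> D\<close> that minimal_poly_nonzero[OF g] c(1)])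
    show "peval e ?y g = c *\<^sub>F u (degree g) c"
      using R(3)[of c] peval_eq_0_iff[OF g, of g] by (simp add: u_def q_def)
  qed (use c(2) in \<open>simp_all add: u_def q_def\<close>)
  ultimately show ?thesis using that by blast
qed

lemma self_centralizing_element_exists:
  assumes D: "domain_subalgebra D e"
  obtains y where "y \<in> D" "y \<noteq> 0" "\<And>b. b \<in> D \<Longrightarrow> b * y = y * b \<Longrightarrow> b \<in> adjoin e y"
proof -
  define Q where "Q k \<longleftrightarrow> (\<exists>y g. y \<in> D \<and> y \<noteq> 0 \<and> minimal_poly e y g \<and> degree g = k)" for k
  have "\<exists>k. Q k"
    using minimal_poly_exists[OF D domain_unit(1)[OF D]] domain_unit[OF D] unfolding Q_def by blast
  moreover have "\<forall>k. Q k \<longrightarrow> k \<le> dim UNIV"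
    using dim_adjoin[OF D] dim_subset[OF subset_UNIV] unfolding Q_def by metis
  ultimately obtain k where k: "Q k" "\<And>l. Q l \<Longrightarrow> l \<le> k"
    using GreatestI_ex_nat[of Q] Greatest_le_nat[of Q] by blast
  then obtain y g where y: "y \<in> D" "y \<noteq> 0" and g: "minimal_poly e y g" "degree g = k"
    unfolding Q_def by blast
  have "b \<in> adjoin e y" if b: "b \<in> D" "b * y = y * b" for b
  proof (rule ccontr)
    assume "b \<notin> adjoin e y"
    then obtain y' where y': "y' \<in> D" "y' \<noteq> 0" "\<And>g'. minimal_poly e y' g' \<Longrightarrow> k < degree g'"
      using larger_degree_exists[OF D y(1) g(1) b] g(2) by blast
    obtain g' where "minimal_poly e y' g'" using minimal_poly_exists[OF D y'(1)] by blast
    then show False using k(2)[of "degree g'"] y' unfolding Q_def by (metis leD)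
  qed
  then show ?thesis using that y by blast
qed

end

subsection \<open>Primitive idempotents and the central projection\<close>

locale prime_fd_algebra = fd_central_algebra \<phi> Basis
  for \<phi> :: "'f::field_char_0 \<Rightarrow> 'v::ring_1" and Basis +
  assumes prime: "prime_ring TYPE('v)"
begin

lemma prime_cases: "(\<And>x. a * x * b = (0 :: 'v)) \<Longrightarrow> a = 0 \<or> b = 0"
  using prime unfolding prime_ring_def by blast

definition right_ideal :: "'v set \<Rightarrow> bool" where
  "right_ideal J \<longleftrightarrow> subspace J \<and> (\<forall>x\<in>J. \<forall>s. x * s \<in> J)"

definition minimal_right_ideal :: "'v set \<Rightarrow> bool" where
  "minimal_right_ideal J \<longleftrightarrow> right_ideal J \<and> J \<noteq> {0} \<and>
     (\<forall>K. right_ideal K \<longrightarrow> K \<subseteq> J \<longrightarrow> K \<noteq> {0} \<longrightarrow> K = J)"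

lemma minimal_right_ideal_exists:
  assumes "right_ideal I" "I \<noteq> {0}"
  obtains J where "minimal_right_ideal J" "J \<subseteq> I"
proof -
  define Q where "Q J \<longleftrightarrow> right_ideal J \<and> J \<subseteq> I \<and> J \<noteq> {0}" for J
  have "Q I" using assms by (simp add: Q_def)
  then obtain J where J: "Q J" "\<And>K. Q K \<Longrightarrow> dim J \<le> dim K"
    using ex_has_least_nat[of Q I dim] by blast
  have "K = J" if "right_ideal K" "K \<subseteq> J" "K \<noteq> {0}" for K
  proof (rule subspace_dim_equal)
    show "dim J \<le> dim K" using that J(1) by (intro J(2)) (auto simp: Q_def)
  qed (use that J(1) in \<open>simp_all add: Q_def right_ideal_def\<close>)
  then have "minimal_right_ideal J" using J(1) by (simp add: minimal_right_ideal_def Q_def)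
  then show ?thesis using that J(1) by (simp add: Q_def)
qed

text \<open>Schur's lemma: the kernel of left multiplication on \<open>J\<close> is again a right ideal.\<close>
lemma minimal_right_ideal_lmult_inj:
  assumes J: "minimal_right_ideal J" and t: "t \<in> J" "a * t \<noteq> 0" and s: "s \<in> J" "a * s = 0"
  shows "s = 0"
proof (rule ccontr)
  assume "s \<noteq> 0"
  let ?K = "{s \<in> J. a * s = 0}"
  have J': "subspace J" "\<And>x s. x \<in> J \<Longrightarrow> x * s \<in> J"
    using J by (simp_all add: minimal_right_ideal_def right_ideal_def)
  then have "right_ideal ?K"
    unfolding right_ideal_def
    by (auto simp: subspace_0 subspace_add subspace_scale distrib_left simp flip: mult.assoc
        intro!: subspaceI)
  then have "?K = J"
    using J s \<open>s \<noteq> 0\<close> unfolding minimal_right_ideal_def by blast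
  then show False using t by blast
qed

definition corner :: "'v \<Rightarrow> 'v set" where
  "corner e = range (\<lambda>s. e * s * e)"

lemma corner_iff:
  assumes "e * e = e"
  shows "x \<in> corner e \<longleftrightarrow> e * x = x \<and> x * e = x"
proof
  assume "x \<in> corner e"
  then obtain s where "x = e * s * e" by (auto simp: corner_def)
  then have "e * x = e * e * s * e" "x * e = e * s * (e * e)" by (simp_all add: mult.assoc)
  then show "e * x = x \<and> x * e = x" using assms \<open>x = e * s * e\<close> by simp
next
  assume "e * x = x \<and> x * e = x"
  then show "x \<in> corner e" unfolding corner_def by (metis rangeI)
qed

lemma corner_domain:
  assumes e: "e * e = e" "e \<noteq> 0"
    and cancel: "\<And>x y. x \<in> corner e \<Longrightarrow> y \<in> corner e \<Longrightarrow> x * y = 0 \<Longrightarrow> x = 0 \<or> y = 0"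
  shows "domain_subalgebra (corner e) e"
  unfolding domain_subalgebra_def
proof (intro conjI ballI impI)
  show "subspace (corner e)"
    unfolding corner_def by (rule op.linear_subspace_image[OF linear_op_mult(2) subspace_UNIV])
  fix x y assume x: "x \<in> corner e" and y: "y \<in> corner e"
  show "x * y \<in> corner e"
    using x y unfolding corner_iff[OF e(1)] by (metis mult.assoc)
  show "x = 0 \<or> y = 0" if "x * y = 0" using cancel[OF x y that] .
qed (use e in \<open>simp_all add: corner_iff\<close>)

lemma primitive_idempotent_exists:
  assumes "right_ideal I" "I \<noteq> {0}"
  obtains e where "e \<in> I" "e * e = e" "domain_subalgebra (corner e) e"
proof -
  obtain J where J: "minimal_right_ideal J" "J \<subseteq> I"
    using minimal_right_ideal_exists[OF assms] .
  then have subspace: "subspace J" and mult: "\<And>x s. x \<in> J \<Longrightarrow> x * s \<in> J" and "J \<noteq> {0}"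
    by (simp_all add: minimal_right_ideal_def right_ideal_def)
  then obtain b where b: "b \<in> J" "b \<noteq> 0" using subspace_0 by blast
  obtain x where "b * x * b \<noteq> 0" using prime_cases[of b b] b(2) by blast
  then have inj: "s = 0" if "s \<in> J" "b * x * s = 0" for s
    using minimal_right_ideal_lmult_inj[OF J(1) b(1) _ that] by blast
  have "(*) (b * x) ` J = J"
    using inj mult b(1) by (intro linear_op_inj_imp_surj_on[OF _ subspace]) simp_all
  then obtain e where e: "e \<in> J" "b * x * e = b * x" using mult[OF b(1)] by (metis imageE)
  have "e * e = e"
  proof -
    have "b * x * (e * e - e) = 0" using e(2) by (simp add: right_diff_distrib flip: mult.assoc)
    then show ?thesis
      using inj[of "e * e - e"] subspace_diff[OF subspace mult[OF e(1)] e(1)] by simp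
  qed
  moreover have "e \<noteq> 0" using e(2) \<open>b * x * b \<noteq> 0\<close> by auto
  moreover have "y = 0 \<or> z = 0" if yz: "y \<in> corner e" "z \<in> corner e" "y * z = 0" for y z
  proof (rule disjCI)
    assume "z \<noteq> 0"
    have "z \<in> J" using yz(2) mult[OF e(1)] by (auto simp: corner_def mult.assoc)
    then have "y * e = 0"
      using minimal_right_ideal_lmult_inj[OF J(1) e(1) _ _ yz(3)] \<open>z \<noteq> 0\<close> by blast
    then show "y = 0" using yz(1) corner_iff[OF \<open>e * e = e\<close>] by simp
  qed
  ultimately show ?thesis using that J(2) e(1) corner_domain by blast
qed

lemma full_trace_unit_nonzero:
  assumes "domain_subalgebra E e"
  shows "\<T> e \<noteq> 0"
proof
  have ee: "e * e = e" using domain_unit_left[OF assms domain_unit(1)[OF assms]] .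
  assume "\<T> e = 0"
  then have "range ((*) e) \<subseteq> {0}"
    unfolding full_trace_idempotent[OF ee] by (simp only: of_nat_eq_0_iff dim_eq_0)
  then have "e * e = 0" by blast
  then show False using ee domain_unit(2)[OF assms] by simp
qed

lemma nondegenerate_domain:
  assumes E: "domain_subalgebra E e"
  shows "nondegenerate_on E"
  unfolding nondegenerate_on_def
proof (intro ballI impI, rule ccontr)
  fix a assume a: "a \<in> E" "\<forall>x\<in>E. \<T> (a * x) = 0" "a \<noteq> 0"
  obtain x where "x \<in> E" "a * x = e" by (rule domain_inverse_exists[OF E a(1,3)])
  then show False using a(2) full_trace_unit_nonzero[OF E] by auto
qed

lemma nondegenerate_UNIV: "nondegenerate_on UNIV"
  unfolding nondegenerate_on_def
proof (intro ballI impI, rule ccontr)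
  fix a assume a: "\<forall>x\<in>UNIV. \<T> (a * x) = 0" "a \<noteq> 0"
  let ?I = "{a. \<forall>x. \<T> (a * x) = 0}"
  have "right_ideal ?I"
    by (auto simp: right_ideal_def distrib_right full_trace_linear mult.assoc intro!: subspaceI)
  then obtain e where e: "e \<in> ?I" "domain_subalgebra (corner e) e"
    using primitive_idempotent_exists[of ?I] a by blast
  have "\<T> (e * 1) = 0" using e(1) by blast
  then show False using full_trace_unit_nonzero[OF e(2)] by simp
qed

lemma full_trace_eqI: "(\<And>x. \<T> (a * x) = \<T> (b * x)) \<Longrightarrow> a = b"
  by (rule nondegenerate_eqI[OF nondegenerate_UNIV]) simp_all

lemma center_commute: "z \<in> ring_center \<Longrightarrow> z * x = x * (z :: 'v)"
  unfolding ring_center_def by blast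

lemma center_left_commute: "z \<in> ring_center \<Longrightarrow> x * (z * y) = z * (x * (y :: 'v))"
  by (metis center_commute mult.assoc)

lemma center_domain: "domain_subalgebra ring_center 1"
  unfolding domain_subalgebra_def
proof (intro conjI ballI impI)
  show "subspace ring_center"
    by (rule subspaceI) (auto simp: ring_center_def algebra_simps)
  fix x y :: 'v assume x: "x \<in> ring_center" and y: "y \<in> ring_center"
  show "x * y \<in> ring_center"
    unfolding ring_center_def mem_Collect_eq using x y by (metis center_commute mult.assoc)
  assume "x * y = 0"
  then show "x = 0 \<or> y = 0"
    using center_commute[OF x] by (intro prime_cases) (simp add: mult.assoc)
qed (simp_all add: ring_center_def)

text \<open>The Casimir operator does not depend on the choice of dual bases.\<close>
definition central_projection :: "'v \<Rightarrow> 'v" where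
  "central_projection =
     (SOME C. \<exists>(B :: 'v set) a. dual_bases UNIV B a (\<lambda>b. b) \<and> C = casimir B a (\<lambda>b. b))"

lemma central_projection_casimir:
  obtains B :: "'v set" and a where "dual_bases UNIV B a (\<lambda>b. b)"
    "central_projection = casimir B a (\<lambda>b. b)"
proof -
  obtain B :: "'v set" and a where "dual_bases UNIV B a (\<lambda>b. b)"
    using dual_bases_exist[OF subspace_UNIV nondegenerate_UNIV] .
  then have "\<exists>C. \<exists>(B :: 'v set) a. dual_bases UNIV B a (\<lambda>b. b) \<and> C = casimir B a (\<lambda>b. b)" by blast
  from someI_ex[OF this] show ?thesis using that unfolding central_projection_def by blast
qed

lemma linear_op_central_projection: "linear_op central_projection"
  using central_projection_casimir linear_op_casimir by metis

lemma central_projection_in_center: "central_projection s \<in> ring_center"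
proof -
  obtain B :: "'v set" and a where dual: "dual_bases UNIV B a (\<lambda>b. b)"
    and C: "central_projection = casimir B a (\<lambda>b. b)"
    by (rule central_projection_casimir)
  have "central_projection s * x = x * central_projection s" for x
    unfolding C by (rule casimir_commute[OF subspace_UNIV nondegenerate_UNIV dual, symmetric]) simp_all
  then show ?thesis by (simp add: ring_center_def)
qed

lemma central_projection_center_mult:
  assumes "z \<in> ring_center"
  shows "central_projection (z * s) = z * central_projection s"
proof -
  obtain B :: "'v set" and a where "central_projection = casimir B a (\<lambda>b. b)"
    by (rule central_projection_casimir)
  then show ?thesis
    by (simp add: casimir_def sum_distrib_left mult.assoc center_left_commute[OF assms])
qed

lemma trace_lmult_rmult_central_projection:
  "trace_on UNIV (\<lambda>r. x * r * y) = \<T> (central_projection x * y)"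
  using central_projection_casimir trace_lmult_rmult by metis

lemma full_trace_central_projection: "\<T> (central_projection x) = \<T> x"
  using trace_lmult_rmult_central_projection[of x 1] by (simp add: regular_trace_def)

lemma symmetric_form_central_projection:
  assumes t: "linear_form t" and sym: "\<And>x y. t (x * y) = t (y * x)"
  shows "t (central_projection x) = t x"
proof -
  obtain B :: "'v set" and a where C: "central_projection = casimir B a (\<lambda>b. b)"
    by (rule central_projection_casimir)
  have eq: "t (central_projection x) = t ((\<Sum>b\<in>B. b * a b) * x)"
    if "linear_form t" "\<And>x y. t (x * y) = t (y * x)" for t x
  proof -
    have "t (central_projection x) = (\<Sum>b\<in>B. t (b * (a b * x)))"
      using that(2) by (simp add: C casimir_def form.linear_sum[OF that(1)])
    then show ?thesis by (simp add: sum_distrib_right form.linear_sum[OF that(1)] mult.assoc)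
  qed
  have "(\<Sum>b\<in>B. b * a b) = 1"
    using eq[OF linear_form_full_trace full_trace_commute] full_trace_central_projection
    by (intro full_trace_eqI) simp
  then show ?thesis using eq[OF t sym] by simp
qed

lemma full_trace_center_mult_idempotent:
  assumes e: "e * e = e" and z: "z \<in> ring_center"
  shows "of_nat (dim UNIV) * \<T> (z * e) = \<T> e * \<T> z"
proof -
  note Z = center_domain
  have "x * e = e * x" if "x \<in> ring_center" for x by (rule center_commute[OF that])
  then obtain n where n: "\<And>x. x \<in> ring_center \<Longrightarrow> \<T> (x * e) = of_nat n * regular_trace ring_center x"
    using full_trace_mult_idempotent_domain[OF Z e] by auto
  obtain k where k: "\<And>x. x \<in> ring_center \<Longrightarrow> \<T> x = of_nat k * regular_trace ring_center x"
    using full_trace_on_domain[OF Z] by blast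
  have "of_nat (dim UNIV) * \<T> (z * e) = \<T> 1 * \<T> (z * e)" by (simp only: full_trace_1)
  also have "\<dots> = \<T> (1 * e) * \<T> z"
    unfolding k[OF domain_unit(1)[OF Z]] k[OF z] n[OF domain_unit(1)[OF Z]] n[OF z]
    by (simp only: mult_ac)
  finally show ?thesis by simp
qed

lemma central_projection_idempotent:
  assumes e: "e * e = e"
  shows "of_nat (dim UNIV) *\<^sub>F central_projection e = \<T> e *\<^sub>F 1"
proof (rule full_trace_eqI)
  fix x
  let ?C = central_projection
  note C = central_projection_in_center
  have "?C (?C e * x) = ?C (?C x * e)"
    unfolding central_projection_center_mult[OF C] by (rule center_commute[OF C])
  then have "\<T> (?C e * x) = \<T> (?C (?C x * e))" by (metis full_trace_central_projection)
  also have "\<dots> = \<T> (?C x * e)" by (rule full_trace_central_projection)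
  finally have "of_nat (dim UNIV) * \<T> (?C e * x) = \<T> e * \<T> x"
    using full_trace_center_mult_idempotent[OF e C[of x]]
    by (simp only: full_trace_central_projection)
  then show "\<T> (of_nat (dim UNIV) *\<^sub>F ?C e * x) = \<T> (\<T> e *\<^sub>F 1 * x)"
    by (simp add: full_trace_linear)
qed

subsection \<open>The reduced degree\<close>

lemma dim_domain_pos:
  assumes "domain_subalgebra E e"
  shows "dim E > 0"
  using domain_unit[OF assms] dim_eq_0[of E] by (metis gr0I singletonD subsetD)

lemma casimir_in_self_centralizing:
  assumes e: "e * e = e" and E: "domain_subalgebra E e" and dual: "dual_bases E I a b"
    and cent: "\<And>x. x \<in> corner e \<Longrightarrow> (\<And>y. y \<in> E \<Longrightarrow> x * y = y * x) \<Longrightarrow> x \<in> E"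
  shows "casimir I a b s \<in> E"
proof (rule cent)
  have "a i \<in> E" "b i \<in> E" if "i \<in> I" for i
    using dual that frame_in by (auto simp: dual_bases_def)
  then have "e * casimir I a b s = casimir I a b s" "casimir I a b s * e = casimir I a b s"
    using domain_unit_left[OF E] domain_unit_right[OF E]
    by (simp_all add: casimir_def sum_distrib_left sum_distrib_right mult.assoc)
      (simp add: mult.assoc[symmetric])
  then show "casimir I a b s \<in> corner e" by (simp add: corner_iff[OF e])
  show "casimir I a b s * y = y * casimir I a b s" if "y \<in> E" for y
    by (rule casimir_commute[OF domain_subspace[OF E] nondegenerate_domain[OF E] dual that
          domain_mult[OF E], symmetric])
qed

lemma casimir_on_commutative:
  assumes E: "domain_subalgebra E e" and comm: "\<And>x y. x \<in> E \<Longrightarrow> y \<in> E \<Longrightarrow> x * y = y * x"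
    and n: "\<And>x. x \<in> E \<Longrightarrow> \<T> x = of_nat n * regular_trace E x"
    and dual: "dual_bases E I a b" and x: "x \<in> E" "casimir I a b x \<in> E"
  shows "of_nat n *\<^sub>F casimir I a b x = x"
proof (rule nondegenerate_eqI[OF nondegenerate_domain[OF E] domain_subspace[OF E] _ x(1)])
  show "of_nat n *\<^sub>F casimir I a b x \<in> E" by (rule subspace_scale[OF domain_subspace[OF E] x(2)])
  have fr: "frame E I b (\<lambda>i x. \<T> (a i * x))" using dual by (simp add: dual_bases_def)
  fix s assume s: "s \<in> E"
  have "b i * s = s * b i" if "i \<in> I" for i using comm[OF frame_in[OF fr that] s] .
  then have "\<T> (casimir I a b x * s) = (\<Sum>i\<in>I. \<T> (a i * (x * s * b i)))"
    by (simp add: casimir_def sum_distrib_right full_trace_linear mult.assoc)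
  also have "\<dots> = regular_trace E (x * s)"
    unfolding regular_trace_def[of E] using domain_mult[OF E] x(1) s
    by (intro trace_on_frame[OF domain_subspace[OF E] fr, symmetric]) simp_all
  finally show "\<T> (of_nat n *\<^sub>F casimir I a b x * s) = \<T> (x * s)"
    using n[OF domain_mult[OF E x(1) s]] by (simp add: full_trace_linear)
qed

lemma trace_casimir_self_centralizing:
  assumes e: "e * e = e" and E: "domain_subalgebra E e"
    and comm: "\<And>x y. x \<in> E \<Longrightarrow> y \<in> E \<Longrightarrow> x * y = y * x"
    and cent: "\<And>x. x \<in> corner e \<Longrightarrow> (\<And>y. y \<in> E \<Longrightarrow> x * y = y * x) \<Longrightarrow> x \<in> E"
    and n: "\<And>x. x \<in> E \<Longrightarrow> \<T> x = of_nat n * regular_trace E x"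
    and dual: "dual_bases E I a b"
  shows "of_nat n * trace_on UNIV (casimir I a b) = of_nat (dim E)"
proof -
  have in_E: "casimir I a b s \<in> E" for s
    by (rule casimir_in_self_centralizing[OF e E dual cent])
  have "n \<noteq> 0" using n[OF domain_unit(1)[OF E]] full_trace_unit_nonzero[OF E] by auto
  have "trace_on UNIV (casimir I a b) = inverse (of_nat n) * of_nat (dim E)"
  proof (rule trace_on_scalar_image[OF domain_subspace[OF E] subspace_UNIV subset_UNIV
        linear_op_casimir in_E])
    fix x assume x: "x \<in> E"
    have "of_nat n *\<^sub>F casimir I a b x = x"
      by (rule casimir_on_commutative[OF E comm n dual x in_E])
    then show "casimir I a b x = inverse (of_nat n) *\<^sub>F x"
      using \<open>n \<noteq> 0\<close> by (metis left_inverse of_nat_eq_0_iff scale_one scale_scale)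
  qed
  then show ?thesis using \<open>n \<noteq> 0\<close> by simp
qed

lemma dim_center_mult_idempotent:
  assumes "e \<noteq> 0"
  shows "dim ((\<lambda>z. z * e) ` ring_center) = dim (ring_center :: 'v set)"
proof (rule op.dim_image_eq[OF linear_op_mult(3)])
  note Z = domain_subspace[OF center_domain]
  have "z = 0" if z: "z \<in> ring_center" "z * e = 0" for z
  proof (rule ccontr)
    assume "z \<noteq> 0"
    then obtain w where "w * z = 1" by (rule domain_inverse_exists[OF center_domain z(1)])
    then have "e = w * (z * e)" by (simp flip: mult.assoc)
    then show False using z(2) assms by simp
  qed
  then have "inj_on (\<lambda>z. z * e) ring_center"
    using op.linear_inj_on_iff_eq_0[OF linear_op_mult(3) Z] by blast
  then show "inj_on (\<lambda>z. z * e) (span ring_center)" using Z by (simp add: span_eq_iff[THEN iffD2])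
qed

lemma trace_central_projection_mult:
  assumes e: "e * e = e" and E: "domain_subalgebra E e" and Ze: "(\<lambda>z. z * e) ` ring_center \<subseteq> E"
  shows "of_nat (dim UNIV) * trace_on E (\<lambda>s. central_projection s * e) =
    \<T> e * of_nat (dim (ring_center :: 'v set))"
proof -
  let ?N = "of_nat (dim UNIV) :: 'f" and ?Ze = "(\<lambda>z. z * e) ` ring_center"
  have N: "?N \<noteq> 0"
    using dim_domain_pos[OF center_domain] dim_subset[of ring_center UNIV]
    by (simp only: of_nat_eq_0_iff) auto
  have "trace_on E (\<lambda>s. central_projection s * e) = (\<T> e / ?N) * of_nat (dim ?Ze)"
  proof (rule trace_on_scalar_image[OF _ domain_subspace[OF E] Ze])
    show "subspace ?Ze"
      by (rule op.linear_subspace_image[OF linear_op_mult(3) domain_subspace[OF center_domain]])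
    show "linear_op (\<lambda>s. central_projection s * e)"
      by (rule linear_op_compose[OF linear_op_mult(3) linear_op_central_projection])
    show "central_projection s * e \<in> ?Ze" for s using central_projection_in_center by blast
    fix x assume "x \<in> ?Ze"
    then obtain z where z: "z \<in> ring_center" "x = z * e" by blast
    have "central_projection e = (\<T> e / ?N) *\<^sub>F 1"
      using N arg_cong[OF central_projection_idempotent[OF e], of "(*\<^sub>F) (inverse ?N)"]
      by (simp add: divide_inverse mult.commute)
    then show "central_projection x * e = (\<T> e / ?N) *\<^sub>F x"
      by (simp add: z(2) central_projection_center_mult[OF z(1)])
  qed
  then show ?thesis
    using N dim_center_mult_idempotent[OF domain_unit(2)[OF E]] by (simp)
qed

lemma trace_casimir_eq_trace_central_projection:
  assumes E: "domain_subalgebra E e" and Ze: "(\<lambda>z. z * e) ` ring_center \<subseteq> E"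
    and dual: "dual_bases E I a b"
  shows "trace_on UNIV (casimir I a b) = trace_on E (\<lambda>s. central_projection s * e)"
proof -
  let ?C = central_projection
  note E' = domain_subspace[OF E] nondegenerate_domain[OF E]
  have fr: "frame E I a (\<lambda>i x. \<T> (b i * x))" and b: "\<And>i. i \<in> I \<Longrightarrow> b i \<in> E"
    using dual_bases_commute[OF E' dual] by (simp_all add: dual_bases_def)
  have "trace_on UNIV (casimir I a b) = (\<Sum>i\<in>I. trace_on UNIV (\<lambda>r. a i * r * b i))"
    unfolding casimir_def by (intro trace_on_sum) simp_all
  also have "\<dots> = (\<Sum>i\<in>I. \<T> (b i * (?C (a i) * e)))"
  proof (rule sum.cong[OF refl])
    fix i assume "i \<in> I"
    then have "?C (a i) * b i = b i * (?C (a i) * e)"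
      using domain_unit_right[OF E b]
      by (simp add: center_left_commute[OF central_projection_in_center, of "b i"])
    then show "trace_on UNIV (\<lambda>r. a i * r * b i) = \<T> (b i * (?C (a i) * e))"
      by (simp add: trace_lmult_rmult_central_projection)
  qed
  also have "\<dots> = trace_on E (\<lambda>s. ?C s * e)"
  proof (rule trace_on_frame[OF E'(1) fr, symmetric])
    show "linear_op (\<lambda>s. ?C s * e)"
      by (rule linear_op_compose[OF linear_op_mult(3) linear_op_central_projection])
  qed (use Ze central_projection_in_center in blast)
  finally show ?thesis .
qed

lemma self_centralizing_dim:
  assumes E: "domain_subalgebra E e" "E \<subseteq> corner e"
    and comm: "\<And>x y. x \<in> E \<Longrightarrow> y \<in> E \<Longrightarrow> x * y = y * x"
    and cent: "\<And>x. x \<in> corner e \<Longrightarrow> (\<And>y. y \<in> E \<Longrightarrow> x * y = y * x) \<Longrightarrow> x \<in> E"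
  obtains n where "\<T> e = of_nat (n * dim E)" "dim UNIV = n\<^sup>2 * dim (ring_center :: 'v set)"
proof -
  have e: "e * e = e" using domain_unit_left[OF E(1) domain_unit(1)[OF E(1)]] .
  obtain n where n: "\<And>x. x \<in> E \<Longrightarrow> \<T> x = of_nat n * regular_trace E x"
    using full_trace_on_domain[OF E(1)] by blast
  then have full_trace_e: "\<T> e = of_nat (n * dim E)"
    using domain_unit(1)[OF E(1)] regular_trace_unit[OF E(1)] by simp
  obtain B :: "'v set" and a where dual: "dual_bases E B a (\<lambda>b. b)"
    using dual_bases_exist[OF domain_subspace[OF E(1)] nondegenerate_domain[OF E(1)]] .
  let ?tr = "trace_on UNIV (casimir B a (\<lambda>b. b))"
  have "(\<lambda>z. z * e) ` ring_center \<subseteq> E"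
  proof (rule image_subsetI, rule cent)
    fix z :: 'v assume z: "z \<in> ring_center"
    show "z * e \<in> corner e"
      by (simp add: corner_iff[OF e] center_left_commute[OF z] e mult.assoc)
    show "z * e * y = y * (z * e)" if "y \<in> E" for y
      using domain_unit_left[OF E(1) that] domain_unit_right[OF E(1) that]
      by (simp add: center_left_commute[OF z] mult.assoc)
  qed
  then have center_trace: "of_nat (dim UNIV) * ?tr = \<T> e * of_nat (dim (ring_center :: 'v set))"
    using trace_casimir_eq_trace_central_projection[OF E(1) _ dual]
      trace_central_projection_mult[OF e E(1)] by metis
  have "of_nat n * ?tr = of_nat (dim E)"
    by (rule trace_casimir_self_centralizing[OF e E(1) comm cent n dual])
  then have "of_nat (dim UNIV * dim E) = of_nat n * (of_nat (dim UNIV) * ?tr)"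
    by (metis of_nat_mult mult.left_commute)
  also have "\<dots> = of_nat (n\<^sup>2 * dim (ring_center :: 'v set) * dim E)"
    by (simp only: center_trace full_trace_e of_nat_mult power2_eq_square mult_ac)
  finally have "dim UNIV * dim E = n\<^sup>2 * dim (ring_center :: 'v set) * dim E"
    by (simp only: of_nat_eq_iff)
  then have "dim UNIV = n\<^sup>2 * dim (ring_center :: 'v set)"
    by (rule mult_right_cancel[THEN iffD1, rotated]) (use dim_domain_pos[OF E(1)] in linarith)
  with full_trace_e show ?thesis by (rule that)
qed

lemma self_centralizing_field_exists:
  obtains e y n where "domain_subalgebra (corner e) e" "y \<in> corner e" "y \<noteq> 0"
    "\<T> e = of_nat (n * dim (adjoin e y))" "dim UNIV = n\<^sup>2 * dim (ring_center :: 'v set)"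
proof -
  have "right_ideal UNIV" by (simp add: right_ideal_def)
  moreover have "(UNIV :: 'v set) \<noteq> {0}" using one_neq_zero by blast
  ultimately obtain e where e: "domain_subalgebra (corner e) e"
    using primitive_idempotent_exists by blast
  obtain y where y: "y \<in> corner e" "y \<noteq> 0"
    "\<And>b. b \<in> corner e \<Longrightarrow> b * y = y * b \<Longrightarrow> b \<in> adjoin e y"
    using self_centralizing_element_exists[OF e] by blast
  obtain n where "\<T> e = of_nat (n * dim (adjoin e y))"
    "dim UNIV = n\<^sup>2 * dim (ring_center :: 'v set)"
    using self_centralizing_dim[OF adjoin_domain[OF e y(1)] adjoin_subset[OF e y(1)]
        adjoin_commute[OF e y(1)]] y(3) generator_in_adjoin[OF e y(1)] by blast
  then show ?thesis using that e y by blast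
qed

lemma red_deg_eqI:
  assumes "dim UNIV = n\<^sup>2 * dim (ring_center :: 'v set)"
  shows "red_deg \<phi> = n"
  unfolding red_deg_def center_deg_def assms
  using dim_domain_pos[OF center_domain] by (intro the_equality) (simp_all)

text \<open>By \<open>symmetric_form_central_projection\<close> it is enough to treat the centre; there both forms are
  multiples of the trace of the subfield generated by \<open>w\<close>, which contains \<open>z = w\<^sup>-\<^sup>1\<close>.\<close>
lemma cayley_hamilton_trace_proportional:
  assumes t: "linear_form t" and sym: "\<And>x y. t (x * y) = t (y * x)"
    and ch: "\<And>x. cayley_hamilton_at t m x"
  shows "of_nat (dim UNIV) * t x = t 1 * \<T> x"
proof -
  note Z = center_domain
  have center: "\<T> 1 * t z = t 1 * \<T> z" if z: "z \<in> ring_center" for z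
  proof (cases "z = 0")
    case True
    then show ?thesis by (simp add: form.linear_0[OF t] full_trace_linear)
  next
    case False
    obtain w where w: "w \<in> ring_center" "z * w = 1" "w * z = 1"
      by (rule domain_inverse_exists[OF Z z False])
    obtain b where b: "t 1 = of_nat b * regular_trace (adjoin 1 w) 1"
      "t z = of_nat b * regular_trace (adjoin 1 w) z"
      using cayley_hamilton_trace_adjoin[OF Z z w t ch] by blast
    have K: "domain_subalgebra (adjoin 1 w) 1" by (rule adjoin_domain[OF Z w(1)])
    obtain n where n: "\<And>x. x \<in> adjoin 1 w \<Longrightarrow> \<T> x = of_nat n * regular_trace (adjoin 1 w) x"
      using full_trace_on_domain[OF K] by blast
    have "w \<noteq> 0" using w(2) by auto
    then obtain v where v: "v \<in> adjoin 1 w" "v * w = 1"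
      by (rule domain_inverse_exists[OF K generator_in_adjoin[OF Z w(1)]])
    have "z = v * w * z" by (simp add: v(2))
    also have "\<dots> = v" by (simp add: mult.assoc w(3))
    finally have "z \<in> adjoin 1 w" using v(1) by simp
    then show ?thesis using n[OF domain_unit(1)[OF K]] n[of z] b by simp
  qed
  show ?thesis
    using center[OF central_projection_in_center, of x]
    by (simp only: symmetric_form_central_projection[OF t sym] full_trace_central_projection
        full_trace_1)
qed

theorem cayley_hamilton_trace_eq_multiple:
  assumes t: "linear_form t" and sym: "\<And>x y. t (x * y) = t (y * x)"
    and t1: "t 1 = of_nat m" and ch: "\<And>x. cayley_hamilton_at t m x"
  shows "\<exists>r. r > 0 \<and> m = r * ring_index \<phi> \<and> (\<forall>x. t x = of_nat r * (\<T> x / of_nat (red_deg \<phi>)))"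
proof -
  obtain e y n where D: "domain_subalgebra (corner e) e" and y: "y \<in> corner e" "y \<noteq> 0"
    and full_trace_e: "\<T> e = of_nat (n * dim (adjoin e y))"
    and dim: "dim UNIV = n\<^sup>2 * dim (ring_center :: 'v set)"
    by (rule self_centralizing_field_exists)
  define p where "p = dim (ring_center :: 'v set)"
  define q where "q = dim (adjoin e y)"
  have pos: "p > 0" "q > 0" "n > 0"
    using dim_domain_pos[OF center_domain] dim_domain_pos[OF adjoin_domain[OF D y(1)]]
      full_trace_unit_nonzero[OF D] by (auto simp: p_def q_def full_trace_e intro!: gr0I)
  obtain x where x: "x \<in> corner e" "y * x = e" "x * y = e"
    by (rule domain_inverse_exists[OF D y])
  obtain r where r: "t e = of_nat (r * q)"
    using cayley_hamilton_trace_adjoin[OF D x(1) y(1) x(3,2) t ch]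
      regular_trace_unit[OF adjoin_domain[OF D y(1)]] by (auto simp: q_def)
  have propor: "of_nat (n\<^sup>2 * p) * t x = of_nat m * \<T> x" for x
    using cayley_hamilton_trace_proportional[OF t sym ch, of x] by (simp only: dim p_def t1)
  have "(of_nat (n\<^sup>2 * p * (r * q)) :: 'f) = of_nat (m * (n * q))"
    using propor[of e] by (simp only: r full_trace_e q_def of_nat_mult)
  then have "n\<^sup>2 * p * (r * q) = m * (n * q)" by (simp only: of_nat_eq_iff)
  then have m: "m = r * (n * p)" using pos by (simp add: power2_eq_square mult_ac)
  have "t x = of_nat r * (\<T> x / of_nat n)" for x
  proof -
    have "of_nat (n * p) * (of_nat n * t x) = of_nat (n * p) * (of_nat r * \<T> x)"
      using propor[of x] by (simp only: m power2_eq_square of_nat_mult mult_ac)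
    then have "of_nat n * t x = of_nat r * \<T> x" using pos by simp
    then show ?thesis using pos by (simp add: field_simps)
  qed
  moreover have "ring_index \<phi> = n * p"
    by (simp add: ring_index_def red_deg_eqI[OF dim] center_deg_def p_def)
  moreover have "m > 0"
    using ch[of 1] by (cases m) (simp_all add: cayley_hamilton_at_def)
  ultimately show ?thesis using m red_deg_eqI[OF dim] by auto
qed

end

subsection \<open>Scalar extension\<close>

locale scalar_extension_algebra =
  fixes A :: "'r::ring_1 set"
    and j :: "'r \<Rightarrow> 'f::field_char_0"
    and \<phi> :: "'f \<Rightarrow> 'v::ring_1"
    and \<iota> :: "'r \<Rightarrow> 'v"
    and \<tau> :: "'r \<Rightarrow> 'r"
  assumes subring: "is_subring A"
    and extension: "scalar_extension A j \<phi> \<iota>"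
    and trace: "is_trace A \<tau>"
begin

sublocale central_algebra \<phi>
  using extension unfolding scalar_extension_def by unfold_locales blast+

lemma A_closed:
  "0 \<in> A" "1 \<in> A" "x \<in> A \<Longrightarrow> y \<in> A \<Longrightarrow> x + y \<in> A" "x \<in> A \<Longrightarrow> y \<in> A \<Longrightarrow> x * y \<in> A"
  using subring unfolding is_subring_def by blast+

lemma iota_1: "\<iota> 1 = 1" and iota_add: "\<iota> (x + y) = \<iota> x + \<iota> y"
  and iota_mult: "\<iota> (x * y) = \<iota> x * \<iota> y" and inj_iota: "inj \<iota>"
  and phi_j: "a \<in> A \<Longrightarrow> \<phi> (j a) = \<iota> a"
  and fraction: "\<exists>a\<in>A. \<exists>b\<in>A. b \<noteq> 0 \<and> c = j a / j b"
  and phi_iota: "\<exists>c r. s = \<phi> c * \<iota> r"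
  using extension unfolding scalar_extension_def by blast+

lemma tau_in: "\<tau> x \<in> A" and tau_add: "\<tau> (x + y) = \<tau> x + \<tau> y"
  and tau_scale: "a \<in> A \<Longrightarrow> \<tau> (a * x) = a * \<tau> x" and tau_commute: "\<tau> (x * y) = \<tau> (y * x)"
  using trace unfolding is_trace_def by blast+

lemma iota_0: "\<iota> 0 = 0"
  using iota_add[of 0 0] by simp

lemma iota_sum: "\<iota> (\<Sum>i\<in>I. v i) = (\<Sum>i\<in>I. \<iota> (v i))"
  by (induction I rule: infinite_finite_induct) (auto simp: iota_0 iota_add)

lemma scale_iota_cases:
  obtains c r where "s = c *\<^sub>F \<iota> r"
  using phi_iota by (metis fscale_def)

lemma scale_iota: "a \<in> A \<Longrightarrow> j a *\<^sub>F \<iota> r = \<iota> (a * r)"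
  by (simp add: fscale_def phi_j iota_mult)

lemma j_eqI:
  assumes "c *\<^sub>F 1 = \<iota> a" "a \<in> A"
  shows "j a = c"
proof -
  have "j a *\<^sub>F 1 = c *\<^sub>F 1" using assms phi_j[of a] phi_eq_scale[of "j a"] by simp
  then show ?thesis by simp
qed

lemma j_ring_hom:
  assumes "a \<in> A" "b \<in> A"
  shows j_add: "j (a + b) = j a + j b" and j_mult: "j (a * b) = j a * j b"
  using assms A_closed
  by (auto intro!: j_eqI simp: phi_j iota_add iota_mult phi_add phi_mult simp flip: phi_eq_scale)

lemma j_of_nat: "j (of_nat n) = of_nat n"
proof (rule j_eqI)
  show "of_nat n \<in> A" by (induction n) (simp_all add: A_closed)
  show "of_nat n *\<^sub>F 1 = \<iota> (of_nat n)"
    by (induction n) (simp_all add: iota_0 iota_1 iota_add scale_left_distrib)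
qed

lemma j_eq_0: "a \<in> A \<Longrightarrow> j a = 0 \<Longrightarrow> a = 0"
  using phi_j[of a] injD[OF inj_iota, of a 0] by (simp add: iota_0 phi_eq_scale)

lemma common_denominator:
  obtains d a a' where "a \<in> A" "a' \<in> A" "d \<noteq> 0" "c = d * j a" "c' = d * j a'"
proof -
  obtain a b where ab: "a \<in> A" "b \<in> A" "b \<noteq> 0" "c = j a / j b" using fraction by blast
  obtain a' b' where ab': "a' \<in> A" "b' \<in> A" "b' \<noteq> 0" "c' = j a' / j b'" using fraction by blast
  have "j b \<noteq> 0" "j b' \<noteq> 0" using j_eq_0 ab ab' by blast+
  then show ?thesis
    using ab ab' A_closed(4)
    by (intro that[of "a * b'" "a' * b" "inverse (j b * j b')"]) (simp_all add: j_mult field_simps)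
qed

lemma prime_scalar_extension:
  assumes "prime_ring TYPE('r)"
  shows "prime_ring TYPE('v)"
  unfolding prime_ring_def
proof (intro allI impI)
  fix a b :: 'v assume ab: "\<forall>x. a * x * b = 0"
  obtain c r c' r' where cr: "a = c *\<^sub>F \<iota> r" "b = c' *\<^sub>F \<iota> r'" by (metis scale_iota_cases)
  show "a = 0 \<or> b = 0"
  proof (rule ccontr)
    assume "\<not> (a = 0 \<or> b = 0)"
    then have nz: "c \<noteq> 0" "c' \<noteq> 0" "r \<noteq> 0" "r' \<noteq> 0" by (auto simp: cr iota_0)
    have "r * x * r' = 0" for x
    proof -
      have "\<iota> (r * x * r') = \<iota> 0"
        using ab[rule_format, of "\<iota> x"] nz by (simp add: cr iota_mult iota_0)
      then show ?thesis by (rule injD[OF inj_iota])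
    qed
    then show False using assms nz unfolding prime_ring_def by blast
  qed
qed

lemma finite_basis_exists:
  assumes "fin_gen_module A"
  shows "\<exists>B. finite B \<and> independent B \<and> span B = UNIV"
proof -
  obtain G where G: "finite G" "\<And>r. \<exists>c. (\<forall>g\<in>G. c g \<in> A) \<and> r = (\<Sum>g\<in>G. c g * g)"
    using assms unfolding fin_gen_module_def by blast
  have span_G: "s \<in> span (\<iota> ` G)" for s
  proof -
    obtain c r where s: "s = c *\<^sub>F \<iota> r" by (rule scale_iota_cases)
    obtain d where d: "\<And>g. g \<in> G \<Longrightarrow> d g \<in> A" "r = (\<Sum>g\<in>G. d g * g)" using G(2)[of r] by blast
    have "\<iota> r = (\<Sum>g\<in>G. j (d g) *\<^sub>F \<iota> g)"
      unfolding d(2) iota_sum using d(1) by (simp add: scale_iota)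
    also have "\<dots> \<in> span (\<iota> ` G)" by (intro span_sum span_scale span_base imageI)
    finally show ?thesis unfolding s by (rule span_scale)
  qed
  obtain B where B: "B \<subseteq> \<iota> ` G" "independent B" "\<iota> ` G \<subseteq> span B"
    by (rule maximal_independent_subset)
  have "span (\<iota> ` G) \<subseteq> span B" using B(3) by (simp add: span_minimal)
  then have "span B = UNIV" using span_G by blast
  moreover have "finite B" using B(1) G(1) finite_subset by blast
  ultimately show ?thesis using B(2) by blast
qed

definition extended_trace :: "'v \<Rightarrow> 'f" where
  "extended_trace s = (SOME v. \<exists>c r. s = c *\<^sub>F \<iota> r \<and> v = c * j (\<tau> r))"

lemma extended_trace_scale_iota: "extended_trace (c *\<^sub>F \<iota> r) = c * j (\<tau> r)"
proof -
  have "\<exists>c' r'. c *\<^sub>F \<iota> r = c' *\<^sub>F \<iota> r' \<and> extended_trace (c *\<^sub>F \<iota> r) = c' * j (\<tau> r')"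
    unfolding extended_trace_def by (rule someI[of _ "c * j (\<tau> r)"]) blast
  then obtain c' r' where eq: "c *\<^sub>F \<iota> r = c' *\<^sub>F \<iota> r'"
    and trace: "extended_trace (c *\<^sub>F \<iota> r) = c' * j (\<tau> r')" by blast
  obtain d a a' where d: "a \<in> A" "a' \<in> A" "d \<noteq> 0" "c = d * j a" "c' = d * j a'"
    by (rule common_denominator)
  have "d *\<^sub>F \<iota> (a * r) = d *\<^sub>F \<iota> (a' * r')"
    using eq d by (simp flip: scale_iota)
  then have "a * r = a' * r'" using d(3) injD[OF inj_iota] by simp
  then have "j (a * \<tau> r) = j (a' * \<tau> r')" using d(1,2) by (metis tau_scale)
  then have "c' * j (\<tau> r') = c * j (\<tau> r)" using d(1,2) by (simp add: d(4,5) j_mult tau_in)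
  then show ?thesis using trace by simp
qed

lemma extended_trace_iota: "extended_trace (\<iota> r) = j (\<tau> r)"
  using extended_trace_scale_iota[of 1 r] by simp

lemma linear_form_extended_trace: "linear_form extended_trace"
  unfolding linear_form_iff
proof (intro conjI allI)
  fix s s'
  obtain c r c' r' where s: "s = c *\<^sub>F \<iota> r" "s' = c' *\<^sub>F \<iota> r'" by (metis scale_iota_cases)
  obtain d a a' where d: "a \<in> A" "a' \<in> A" "d \<noteq> 0" "c = d * j a" "c' = d * j a'"
    by (rule common_denominator)
  have "s + s' = d *\<^sub>F \<iota> (a * r + a' * r')"
    using d(1,2) by (simp add: s d(4,5) iota_add scale_right_distrib flip: scale_iota)
  then have "extended_trace (s + s') = d * j (\<tau> (a * r + a' * r'))"
    by (simp only: extended_trace_scale_iota)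
  also have "\<dots> = extended_trace s + extended_trace s'"
    using d A_closed(4) tau_in
    by (simp add: s extended_trace_scale_iota tau_add tau_scale j_add j_mult distrib_left)
  finally show "extended_trace (s + s') = extended_trace s + extended_trace s'" .
next
  fix d s
  obtain c r where "s = c *\<^sub>F \<iota> r" by (rule scale_iota_cases)
  then show "extended_trace (d *\<^sub>F s) = d * extended_trace s"
    by (simp add: extended_trace_scale_iota)
qed

lemma extended_trace_commute: "extended_trace (x * y) = extended_trace (y * x)"
proof -
  obtain c r c' r' where "x = c *\<^sub>F \<iota> r" "y = c' *\<^sub>F \<iota> r'" by (metis scale_iota_cases)
  then show ?thesis
    by (simp add: extended_trace_scale_iota tau_commute[of r r'] flip: iota_mult)
qed

lemma power_scale_iota: "(c *\<^sub>F \<iota> r) ^ k = c ^ k *\<^sub>F \<iota> (r ^ k)"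
  by (induction k) (simp_all add: iota_1 iota_mult)

lemma cayley_hamilton_extended_trace:
  assumes "cayley_hamilton A j \<phi> \<iota> \<tau> m"
  shows "cayley_hamilton_at extended_trace m x"
proof -
  obtain c r where x: "x = c *\<^sub>F \<iota> r" by (rule scale_iota_cases)
  define coef where "coef i = (-1)^i * newton_e (\<lambda>k. j (\<tau> (r ^ k))) i" for i
  have iota_power: "\<iota> r ^ k = \<iota> (r ^ k)" for k using power_scale_iota[of 1 r k] by simp
  have ch: "\<iota> r ^ m + (\<Sum>i\<in>{1..m}. coef i *\<^sub>F \<iota> r ^ (m - i)) = 0"
    using assms unfolding cayley_hamilton_def coef_def fscale_def by blast
  have newton: "newton_e (\<lambda>k. extended_trace (x ^ k)) i =
      c ^ i * newton_e (\<lambda>k. j (\<tau> (r ^ k))) i" for i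
    by (rule newton_e_homogeneous) (simp add: x power_scale_iota extended_trace_scale_iota)
  have coef: "((-1)^i * newton_e (\<lambda>k. extended_trace (x ^ k)) i) *\<^sub>F x ^ (m - i) =
      c ^ m *\<^sub>F (coef i *\<^sub>F \<iota> r ^ (m - i))" if "i \<in> {1..m}" for i
  proof -
    have "c ^ m = c ^ i * c ^ (m - i)" using that by (simp flip: power_add)
    then show ?thesis
      by (simp only: newton) (simp only: x power_scale_iota iota_power scale_scale coef_def mult_ac)
  qed
  have "x ^ m + (\<Sum>i\<in>{1..m}. ((-1)^i * newton_e (\<lambda>k. extended_trace (x ^ k)) i) *\<^sub>F x ^ (m - i)) =
      x ^ m + (\<Sum>i\<in>{1..m}. c ^ m *\<^sub>F (coef i *\<^sub>F \<iota> r ^ (m - i)))"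
    using coef by (intro arg_cong[of _ _ "(+) (x ^ m)"] sum.cong refl)
  also have "\<dots> = c ^ m *\<^sub>F (\<iota> r ^ m + (\<Sum>i\<in>{1..m}. coef i *\<^sub>F \<iota> r ^ (m - i)))"
    by (simp only: x power_scale_iota iota_power scale_right_distrib scale_sum_right)
  finally show ?thesis unfolding cayley_hamilton_at_def by (simp only: ch scale_zero_right)
qed

end

theorem theorem4p2:
  fixes A :: "'r::ring_1 set"
    and j :: "'r \<Rightarrow> 'f::field_char_0"
    and \<phi> :: "'f \<Rightarrow> 'v::ring_1"
    and \<iota> :: "'r \<Rightarrow> 'v"
    and \<tau> :: "'r \<Rightarrow> 'r"
    and m :: nat
  assumes "prime_ring TYPE('r)"
    and "is_subring A" and "A \<subseteq> ring_center"
    and "scalar_extension A j \<phi> \<iota>"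
    and "integrally_closed A j"
    and "fin_gen_module A"
    and "is_trace A \<tau>"
    and "cayley_hamilton A j \<phi> \<iota> \<tau> m"
  shows "\<exists>r::nat. r > 0 \<and> m = r * ring_index \<phi> \<and>
           (\<forall>x. j (\<tau> x) = of_nat r * reduced_trace \<phi> \<iota> x)"
proof -
  interpret scalar_extension_algebra A j \<phi> \<iota> \<tau>
    using assms by unfold_locales
  obtain B where B: "finite B" "independent B" "span B = UNIV"
    using finite_basis_exists[OF assms(6)] by blast
  interpret prime_fd_algebra \<phi> B
    using B prime_scalar_extension[OF assms(1)] by unfold_locales
  have "extended_trace 1 = of_nat m"
    using extended_trace_iota[of 1] assms(8) by (simp add: cayley_hamilton_def iota_1 j_of_nat)
  then obtain r where r: "r > 0" "m = r * ring_index \<phi>"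
    "\<And>s. extended_trace s = of_nat r * (\<T> s / of_nat (red_deg \<phi>))"
    using cayley_hamilton_trace_eq_multiple[OF linear_form_extended_trace extended_trace_commute]
      cayley_hamilton_extended_trace[OF assms(8)] by blast
  have "j (\<tau> x) = of_nat r * reduced_trace \<phi> \<iota> x" for x
    using r(3)[of "\<iota> x"]
    by (simp add: extended_trace_iota reduced_trace_def lin_trace_eq regular_trace_def)
  then show ?thesis using r(1,2) by blast
qed

end
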